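(* For every rectangle $\Omega=[a,b]\times[c,d]$ and every pair of partitions $X_m$, $Y_n$ of $[a,b]$ and $[c,d]$, the quadratic spline quasi-interpolants $S_2$ and $W_2^*$, regarded as operators on $C(\Omega)$ with the supremum norm, satisfy $$\|S_2\|_\infty\le 5\qquad\text{and}\qquad \|W_2^*\|_\infty\le 3 ,$$ where $\|Q\|_\infty$ denotes the operator norm of $Q$ induced by the supremum norm over $\Omega$. In particular these bounds are independent of the triangulation $\mathcal T_{mn}$ of $\Omega$.
   Context: Partition. Let $m,n\ge 1$ be integers, $\Omega=[a,b]\times[c,d]$, $a=x_0<x_1<\dots<x_m=b$ and $c=y_0<y_1<\dots<y_n=d$ (these are $X_m$ and $Y_n$), with the conventions $x_{-1}=x_0$, $x_{m+1}=x_m$, $y_{-1}=y_0$, $y_{n+1}=y_n$. Put $h_i=x_i-x_{i-1}$, $k_j=y_j-y_{j-1}$ (so $h_0=h_{m+1}=k_0=k_{n+1}=0$), $s_i=\frac12(x_{i-1}+x_i)$, $t_j=\frac12(y_{j-1}+y_j)$ for $0\le i\le m+1$, $0\le j\le n+1$. Put $M_{i,j}=(s_i,t_j)$ for these indices and $A_{i,j}=(x_i,y_j)$ for $-1\le i\le m+1$, $-1\le j\le n+1$. The criss-cross triangulation $\mathcal T_{mn}$ of $\Omega$ is obtained by drawing both diagonals in each subrectangle $\Omega_{ij}=[x_{i-1},x_i]\times[y_{j-1},y_j]$, $1\le i\le m$, $1\le j\le n$. B-splines. Choose extended knots $u_{-2}<u_{-1}<u_0<\dots<u_m<u_{m+1}<u_{m+2}$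 with $u_i=x_i$ for $0\le i\le m$, and $v_{-2}<v_{-1}<v_0<\dots<v_n<v_{n+1}<v_{n+2}$ with $v_j=y_j$ for $0\le j\le n$. For $0\le i\le m+1$, $0\le j\le n+1$, the classical B-spline $\overline B_{ij}$ is the unique $C^1$ function on $\mathbb R^2$ that is a polynomial of total degree at most 2 on each triangle of the criss-cross triangulation (both diagonals in each subrectangle) of the grid $\{u_p\}\times\{v_q\}$, vanishes outside the octagon with vertices $(u_{i-2},v_{j-1}),(u_{i-2},v_j),(u_{i-1},v_{j+1}),(u_i,v_{j+1}),(u_{i+1},v_j),(u_{i+1},v_{j-1}),(u_i,v_{j-2}),(u_{i-1},v_{j-2})$, and is normalized by $\overline B_{ij}(u_i,v_j)=\frac{u_{i+1}-u_i}{u_{i+1}-u_{i-1}}\cdot\frac{v_{j+1}-v_j}{v_{j+1}-v_{j-1}}$. Let $\bar h_0=u_0-u_{-1}$, $\bar h_{m+1}=u_{m+1}-u_m$, $\bar k_0=v_0-v_{-1}$, $\bar k_{n+1}=v_{n+1}-v_n$. Define $\alpha_{00}=\frac{\bar h_0+h_1}{h_1}$, $\alpha_{m+1,m+1}=\frac{h_m+\bar h_{m+1}}{h_m}$, $\alpha_{ii}=1$ for $1\le i\le m$, $\alpha_{1,0}=-\frac{\bar h_0}{h_1}$, $\alpha_{m,m+1}=-\frac{\bar h_{m+1}}{h_m}$, all other $\alpha_{ip}=0$; and define $\beta_{jq}$ in the same way with $n,k,\bar k$ in place of $m,h,\bar h$. The B-spline $B_{ij}$ is the restriction to $\Omega$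 of $\sum_{p=0}^{m+1}\sum_{q=0}^{n+1}\alpha_{ip}\beta_{jq}\overline B_{pq}$. The functions $B_{ij}$ are nonnegative, have supports in $\Omega$, and sum to 1. Quasi-interpolants. For $2\le i\le m$ put $\sigma_i=\frac{h_i}{h_{i-1}+h_i}$, $\sigma_i'=1-\sigma_i$; for $2\le j\le n$ put $\tau_j=\frac{k_j}{k_{j-1}+k_j}$, $\tau_j'=1-\tau_j$; and $\sigma_1=\sigma'_{m+1}=\tau_1=\tau'_{n+1}=1$, $\sigma_1'=\sigma_{m+1}=\tau_1'=\tau_{n+1}=0$. For $1\le i\le m$, $1\le j\le n$, $$a_i=-\frac{\sigma_i^2\sigma_{i+1}'}{\sigma_i+\sigma_{i+1}'},\quad c_i=-\frac{\sigma_i(\sigma_{i+1}')^2}{\sigma_i+\sigma_{i+1}'},\quad \bar a_j=-\frac{\tau_j^2\tau_{j+1}'}{\tau_j+\tau_{j+1}'},\quad \bar c_j=-\frac{\tau_j(\tau_{j+1}')^2}{\tau_j+\tau_{j+1}'},$$ and $a_0=c_0=a_{m+1}=c_{m+1}=\bar a_0=\bar c_0=\bar a_{n+1}=\bar c_{n+1}=0$; $b_{ij}=1-(a_i+c_i+\bar a_j+\bar c_j)$. Then $S_2f=\sum_{i=0}^{m+1}\sum_{j=0}^{n+1}\mu_{ij}(f)B_{ij}$ with $\mu_{ij}(f)=b_{ij}f(M_{i,j})+a_if(M_{i-1,j})+c_if(M_{i+1,j})+\bar a_jf(M_{i,j-1})+\bar c_jf(M_{i,j+1})$ (terms with zero coefficient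 are omitted), and $W_2^*f=\sum_{i=0}^{m+1}\sum_{j=0}^{n+1}\mu^*_{ij}(f)B_{ij}$ with $\mu^*_{ij}(f)=2f(M_{i,j})-\frac14[f(A_{i-1,j-1})+f(A_{i-1,j})+f(A_{i,j-1})+f(A_{i,j})]$. *)

theory Defs
  imports "HOL-Analysis.Analysis"
begin

section \<open>Partitions and data points\<close>

text \<open>Index sets contain negative integers, hence knot sequences are functions on \<^typ>\<open>int\<close>
  of which only the values on the relevant finite range matter.\<close>

definition is_partition :: "int \<Rightarrow> real \<Rightarrow> real \<Rightarrow> (int \<Rightarrow> real) \<Rightarrow> bool" where
  "is_partition m a b x \<longleftrightarrow> 1 \<le> m \<and> x 0 = a \<and> x m = b \<and> strict_mono_on {0..m} x"

text \<open>The conventions \<open>x\<^sub>-\<^sub>1 = x\<^sub>0\<close> and \<open>x\<^sub>m\<^sub>+\<^sub>1 = x\<^sub>m\<close> are obtained by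
  clamping the index; consequently \<open>h\<^sub>0 = h\<^sub>m\<^sub>+\<^sub>1 = 0\<close>.\<close>

definition knot :: "int \<Rightarrow> (int \<Rightarrow> real) \<Rightarrow> int \<Rightarrow> real" where
  "knot m x i = x (max 0 (min m i))"

definition step :: "int \<Rightarrow> (int \<Rightarrow> real) \<Rightarrow> int \<Rightarrow> real" where
  "step m x i = knot m x i - knot m x (i - 1)"

definition midknot :: "int \<Rightarrow> (int \<Rightarrow> real) \<Rightarrow> int \<Rightarrow> real" where
  "midknot m x i = (knot m x (i - 1) + knot m x i) / 2"

definition ptM :: "int \<Rightarrow> int \<Rightarrow> (int \<Rightarrow> real) \<Rightarrow> (int \<Rightarrow> real) \<Rightarrow> int \<Rightarrow> int \<Rightarrow> real \<times> real" where
  "ptM m n x y i j = (midknot m x i, midknot n y j)"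

definition ptA :: "int \<Rightarrow> int \<Rightarrow> (int \<Rightarrow> real) \<Rightarrow> (int \<Rightarrow> real) \<Rightarrow> int \<Rightarrow> int \<Rightarrow> real \<times> real" where
  "ptA m n x y i j = (knot m x i, knot n y j)"

definition extended_knots :: "int \<Rightarrow> (int \<Rightarrow> real) \<Rightarrow> (int \<Rightarrow> real) \<Rightarrow> bool" where
  "extended_knots m x u \<longleftrightarrow> strict_mono_on {-2..m + 2} u \<and> (\<forall>i\<in>{0..m}. u i = x i)"


section \<open>Classical B-splines on the criss-cross triangulation\<close>

definition cell_triangles :: "real \<Rightarrow> real \<Rightarrow> real \<Rightarrow> real \<Rightarrow> (real \<times> real) set set" where
  "cell_triangles x0 x1 y0 y1 =
    (let z = ((x0 + x1) / 2, (y0 + y1) / 2) in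
      {convex hull {z, (x0, y0), (x1, y0)}, convex hull {z, (x1, y0), (x1, y1)},
       convex hull {z, (x1, y1), (x0, y1)}, convex hull {z, (x0, y1), (x0, y0)}})"

definition crisscross ::
    "int \<Rightarrow> int \<Rightarrow> (int \<Rightarrow> real) \<Rightarrow> (int \<Rightarrow> real) \<Rightarrow> (real \<times> real) set set" where
  "crisscross m n u v =
    (\<Union>p\<in>{-1..m + 2}. \<Union>q\<in>{-1..n + 2}. cell_triangles (u (p - 1)) (u p) (v (q - 1)) (v q))"

definition quadratic_on :: "(real \<times> real) set \<Rightarrow> (real \<times> real \<Rightarrow> real) \<Rightarrow> bool" where
  "quadratic_on T F \<longleftrightarrow>
    (\<exists>c0 c1 c2 c3 c4 c5. \<forall>x y. (x, y) \<in> T \<longrightarrow>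
      F (x, y) = c0 + c1 * x + c2 * y + c3 * x^2 + c4 * x * y + c5 * y^2)"

definition C1_plane :: "(real \<times> real \<Rightarrow> real) \<Rightarrow> bool" where
  "C1_plane F \<longleftrightarrow> (\<exists>G. continuous_on UNIV G \<and> (\<forall>z. GDERIV F z :> G z))"

definition octagon :: "(int \<Rightarrow> real) \<Rightarrow> (int \<Rightarrow> real) \<Rightarrow> int \<Rightarrow> int \<Rightarrow> (real \<times> real) set" where
  "octagon u v i j = convex hull
    {(u (i - 2), v (j - 1)), (u (i - 2), v j), (u (i - 1), v (j + 1)), (u i, v (j + 1)),
     (u (i + 1), v j), (u (i + 1), v (j - 1)), (u i, v (j - 2)), (u (i - 1), v (j - 2))}"

definition is_classical_bspline ::
    "int \<Rightarrow> int \<Rightarrow> (int \<Rightarrow> real) \<Rightarrow> (int \<Rightarrow> real) \<Rightarrow> int \<Rightarrow> int \<Rightarrow> (real \<times> real \<Rightarrow> real) \<Rightarrow> bool" where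
  "is_classical_bspline m n u v i j F \<longleftrightarrow>
    C1_plane F \<and>
    (\<forall>T\<in>crisscross m n u v. quadratic_on T F) \<and>
    (\<forall>z. z \<notin> octagon u v i j \<longrightarrow> F z = 0) \<and>
    F (u i, v j) = (u (i + 1) - u i) / (u (i + 1) - u (i - 1))
                 * ((v (j + 1) - v j) / (v (j + 1) - v (j - 1)))"

definition classical_bspline ::
    "int \<Rightarrow> int \<Rightarrow> (int \<Rightarrow> real) \<Rightarrow> (int \<Rightarrow> real) \<Rightarrow> int \<Rightarrow> int \<Rightarrow> real \<times> real \<Rightarrow> real" where
  "classical_bspline m n u v i j = (THE F. is_classical_bspline m n u v i j F)"


section \<open>B-splines on the rectangle\<close>

definition alpha :: "int \<Rightarrow> (int \<Rightarrow> real) \<Rightarrow> (int \<Rightarrow> real) \<Rightarrow> int \<Rightarrow> int \<Rightarrow> real" where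
  "alpha m x u i p =
    (let hbar0 = u 0 - u (-1); hbar1 = u (m + 1) - u m in
     if i = 0 \<and> p = 0 then (hbar0 + step m x 1) / step m x 1
     else if i = m + 1 \<and> p = m + 1 then (step m x m + hbar1) / step m x m
     else if 1 \<le> i \<and> i \<le> m \<and> p = i then 1
     else if i = 1 \<and> p = 0 then - hbar0 / step m x 1
     else if i = m \<and> p = m + 1 then - hbar1 / step m x m
     else 0)"

text \<open>Defined on the whole plane; only its values on \<open>\<Omega>\<close> are used. The coefficients
  \<open>\<beta>\<close> are the \<open>\<alpha>\<close> of the second variable.\<close>

definition bspline ::
    "int \<Rightarrow> int \<Rightarrow> (int \<Rightarrow> real) \<Rightarrow> (int \<Rightarrow> real) \<Rightarrow> (int \<Rightarrow> real) \<Rightarrow> (int \<Rightarrow> real) \<Rightarrow>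
     int \<Rightarrow> int \<Rightarrow> real \<times> real \<Rightarrow> real" where
  "bspline m n x y u v i j z =
    (\<Sum>p\<in>{0..m + 1}. \<Sum>q\<in>{0..n + 1}.
      alpha m x u i p * alpha n y v j q * classical_bspline m n u v p q z)"


section \<open>Quasi-interpolants\<close>

text \<open>The quantities \<open>\<tau>\<close>, \<open>\<tau>'\<close> and the barred coefficients are obtained from the following
  ones by replacing \<open>m\<close>, \<open>x\<close> with \<open>n\<close>, \<open>y\<close>.\<close>

definition sigma :: "int \<Rightarrow> (int \<Rightarrow> real) \<Rightarrow> int \<Rightarrow> real" where
  "sigma m x i =
    (if i = 1 then 1 else if i = m + 1 then 0
     else step m x i / (step m x (i - 1) + step m x i))"

definition sigma' :: "int \<Rightarrow> (int \<Rightarrow> real) \<Rightarrow> int \<Rightarrow> real" where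
  "sigma' m x i = 1 - sigma m x i"

definition coef_a :: "int \<Rightarrow> (int \<Rightarrow> real) \<Rightarrow> int \<Rightarrow> real" where
  "coef_a m x i =
    (if 1 \<le> i \<and> i \<le> m
     then - ((sigma m x i)^2 * sigma' m x (i + 1)) / (sigma m x i + sigma' m x (i + 1))
     else 0)"

definition coef_c :: "int \<Rightarrow> (int \<Rightarrow> real) \<Rightarrow> int \<Rightarrow> real" where
  "coef_c m x i =
    (if 1 \<le> i \<and> i \<le> m
     then - (sigma m x i * (sigma' m x (i + 1))^2) / (sigma m x i + sigma' m x (i + 1))
     else 0)"

definition coef_b :: "int \<Rightarrow> int \<Rightarrow> (int \<Rightarrow> real) \<Rightarrow> (int \<Rightarrow> real) \<Rightarrow> int \<Rightarrow> int \<Rightarrow> real" where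
  "coef_b m n x y i j =
    1 - (coef_a m x i + coef_c m x i + coef_a n y j + coef_c n y j)"

definition mu :: "int \<Rightarrow> int \<Rightarrow> (int \<Rightarrow> real) \<Rightarrow> (int \<Rightarrow> real) \<Rightarrow> int \<Rightarrow> int \<Rightarrow>
    (real \<times> real \<Rightarrow> real) \<Rightarrow> real" where
  "mu m n x y i j f =
    coef_b m n x y i j * f (ptM m n x y i j)
    + coef_a m x i * f (ptM m n x y (i - 1) j) + coef_c m x i * f (ptM m n x y (i + 1) j)
    + coef_a n y j * f (ptM m n x y i (j - 1)) + coef_c n y j * f (ptM m n x y i (j + 1))"

definition S2 :: "int \<Rightarrow> int \<Rightarrow> (int \<Rightarrow> real) \<Rightarrow> (int \<Rightarrow> real) \<Rightarrow> (int \<Rightarrow> real) \<Rightarrow> (int \<Rightarrow> real) \<Rightarrow>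
    (real \<times> real \<Rightarrow> real) \<Rightarrow> real \<times> real \<Rightarrow> real" where
  "S2 m n x y u v f z =
    (\<Sum>i\<in>{0..m + 1}. \<Sum>j\<in>{0..n + 1}. mu m n x y i j f * bspline m n x y u v i j z)"

definition mu_star :: "int \<Rightarrow> int \<Rightarrow> (int \<Rightarrow> real) \<Rightarrow> (int \<Rightarrow> real) \<Rightarrow> int \<Rightarrow> int \<Rightarrow>
    (real \<times> real \<Rightarrow> real) \<Rightarrow> real" where
  "mu_star m n x y i j f =
    2 * f (ptM m n x y i j)
    - (f (ptA m n x y (i - 1) (j - 1)) + f (ptA m n x y (i - 1) j)
       + f (ptA m n x y i (j - 1)) + f (ptA m n x y i j)) / 4"

definition W2_star :: "int \<Rightarrow> int \<Rightarrow> (int \<Rightarrow> real) \<Rightarrow> (int \<Rightarrow> real) \<Rightarrow> (int \<Rightarrow> real) \<Rightarrow> (int \<Rightarrow> real) \<Rightarrow>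
    (real \<times> real \<Rightarrow> real) \<Rightarrow> real \<times> real \<Rightarrow> real" where
  "W2_star m n x y u v f z =
    (\<Sum>i\<in>{0..m + 1}. \<Sum>j\<in>{0..n + 1}. mu_star m n x y i j f * bspline m n x y u v i j z)"


section \<open>Supremum norm and operator norm\<close>

text \<open>Both norms take values in the extended reals, so that an upper bound also asserts
  finiteness. Elements of \<open>C(\<Omega>)\<close> are represented by functions on the plane that are continuous
  on \<open>\<Omega>\<close>.\<close>

definition sup_norm :: "(real \<times> real) set \<Rightarrow> (real \<times> real \<Rightarrow> real) \<Rightarrow> ereal" where
  "sup_norm \<Omega> f = (SUP z\<in>\<Omega>. ereal \<bar>f z\<bar>)"

definition op_norm ::
    "(real \<times> real) set \<Rightarrow> ((real \<times> real \<Rightarrow> real) \<Rightarrow> real \<times> real \<Rightarrow> real) \<Rightarrow> ereal" where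
  "op_norm \<Omega> Q = (SUP f\<in>{f. continuous_on \<Omega> f \<and> sup_norm \<Omega> f \<le> 1}. sup_norm \<Omega> (Q f))"

end

theory Submission
  imports Defs
begin

text \<open>
  Both operators have the form \<open>f \<mapsto> \<Sum> \<mu>\<^sub>i\<^sub>j(f) B\<^sub>i\<^sub>j\<close>. If the \<open>B\<^sub>i\<^sub>j\<close> are nonnegative on \<open>\<Omega>\<close>
  and sum to 1 there, the value at a point is a convex combination of the numbers \<open>\<mu>\<^sub>i\<^sub>j(f)\<close>, so the
  operator norm is at most the largest norm of a coefficient functional
  (\<open>quasi_interpolant_bound\<close>). For \<open>W\<^sub>2\<^sup>*\<close> this norm is at most \<open>2 + 4/4 = 3\<close>. For \<open>S\<^sub>2\<close> all four outer weights
  are at most 0 and all five weights sum to 1, so the norm is at most \<open>1 - 2(a + c + a' + c')\<close>, where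
  \<open>-(a + c) = \<sigma>\<^sub>i \<sigma>'\<^sub>i\<^sub>+\<^sub>1 \<le> 1\<close> and likewise in the other variable; this gives 5 (\<open>mu_bound\<close>).

  The work lies in the B-splines, which are given only through a uniqueness description.
  A quadratic polynomial satisfies the trapezoid rule
  \<open>F(B) - F(A) = (\<nabla>F(A) + \<nabla>F(B)) \<bullet> (B - A) / 2\<close>, so a \<open>C\<^sup>1\<close> quadratic spline on the criss-cross
  triangulation satisfies it along every segment inside a triangle (\<open>quadratic_trapezoid\<close>).
  This single identity yields uniqueness: Hermite data
  (value and gradient) that vanish at the corners of a cell force the spline to vanish in that cell,
  and the trapezoid rule along grid edges propagates zero data from the boundary of the support to the
  four inner grid points as soon as one of the four values is zero.

  For existence, note that the same count of data identifies the \<open>C\<^sup>1\<close> quadratic splines with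
  the Hermite data at the grid points that obey the trapezoid rule on grid edges. A product
  \<open>N(x) M(y)\<close> of univariate quadratic \<open>C\<^sup>1\<close> splines supplies such data. On one cell
  the interpolant of a product is an explicit bilinear expression in the
  Bernstein coefficients of the two factors (\<open>patch\<close>); values and gradients on a cell edge depend only
  on data shared by both neighbours, so the patches glue to a \<open>C\<^sup>1\<close> function (\<open>spline\<close>). Taking for
  \<open>N\<close>, \<open>M\<close> the univariate B-splines gives the classical B-spline
  (\<open>classical_bspline_eq_spline\<close>).

  By bilinearity \<open>B\<^sub>i\<^sub>j\<close> is the interpolant of the product of two univariate splines with control
  coefficients \<open>\<alpha>\<^sub>i\<close> and \<open>\<beta>\<^sub>j\<close>. The coefficients \<open>\<alpha>\<close> are exactly those that turn the boundary
  B-splines into B-splines with a triple knot at the end of the interval. Hence all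
  Bernstein coefficients on cells of \<open>\<Omega>\<close> are nonnegative and sum over \<open>i\<close> to 1. As \<open>patch\<close> preserves
  nonnegativity of coefficients and reproduces the constant 1, the \<open>B\<^sub>i\<^sub>j\<close> are nonnegative and sum to 1
  (\<open>bspline_nonneg_sum\<close>).
\<close>

section \<open>Uniqueness of splines with prescribed support\<close>

text \<open>The trapezoid rule is exact for the derivative of a quadratic polynomial in one variable. Only
  the gradient of \<open>F\<close> enters, so data at a vertex are shared by all triangles that meet there.\<close>

lemma quadratic_trapezoid:
  assumes grad: "\<And>z. GDERIV F z :> G z"
    and quad: "quadratic_on T F" and T: "convex T" "A \<in> T" "B \<in> T"
  shows "F B - F A = (G A + G B) \<bullet> (B - A) / 2"
proof -
  define \<phi> where "\<phi> = (\<lambda>t. F (A + t *\<^sub>R (B - A)))"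
  obtain c0 c1 c2 c3 c4 c5 where c: "\<And>x y. (x, y) \<in> T \<Longrightarrow>
      F (x, y) = c0 + c1 * x + c2 * y + c3 * x^2 + c4 * x * y + c5 * y^2"
    using quad unfolding quadratic_on_def by blast
  obtain a1 a2 where A: "A = (a1, a2)" by fastforce
  obtain e1 e2 where E: "B - A = (e1, e2)" by fastforce
  define \<beta> where "\<beta> = c1 * e1 + c2 * e2 + 2 * c3 * a1 * e1 + c4 * (a1 * e2 + a2 * e1) + 2 * c5 * a2 * e2"
  define \<gamma> where "\<gamma> = c3 * e1^2 + c4 * e1 * e2 + c5 * e2^2"
  have \<phi>: "\<phi> t = F A + \<beta> * t + \<gamma> * t^2" if t: "t \<in> {0..1}" for t
  proof -
    have "A + t *\<^sub>R (B - A) = (1 - t) *\<^sub>R A + t *\<^sub>R B" by (simp add: algebra_simps)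
    then have "A + t *\<^sub>R (B - A) \<in> T"
      using T t unfolding convex_def by auto
    then have "(a1 + t * e1, a2 + t * e2) \<in> T"
      by (simp add: A E[unfolded A])
    moreover have "F A = c0 + c1 * a1 + c2 * a2 + c3 * a1^2 + c4 * a1 * a2 + c5 * a2^2"
      using c T(2) A by simp
    ultimately show ?thesis
      using c[of "a1 + t * e1" "a2 + t * e2"]
      unfolding \<phi>_def \<beta>_def \<gamma>_def E by (simp add: A algebra_simps power2_eq_square)
  qed
  have d1: "(\<phi> has_vector_derivative (G (A + t *\<^sub>R (B - A)) \<bullet> (B - A))) (at t within cbox 0 1)" for t
  proof -
    have "(F has_derivative (\<lambda>h. h \<bullet> G (A + t *\<^sub>R (B - A)))) (at (A + t *\<^sub>R (B - A)))"
      using grad[of "A + t *\<^sub>R (B - A)"] by (simp add: gderiv_def)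
    moreover have "((\<lambda>t. A + t *\<^sub>R (B - A)) has_derivative (\<lambda>s. s *\<^sub>R (B - A))) (at t within cbox 0 1)"
      by (auto intro!: derivative_eq_intros)
    ultimately have "(\<phi> has_derivative (\<lambda>s. (s *\<^sub>R (B - A)) \<bullet> G (A + t *\<^sub>R (B - A)))) (at t within cbox 0 1)"
      unfolding \<phi>_def by (rule has_derivative_compose[rotated])
    then show ?thesis
      by (simp add: has_vector_derivative_def inner_commute mult.commute)
  qed
  have d2: "(\<phi> has_vector_derivative (\<beta> + 2 * \<gamma> * t)) (at t within cbox 0 1)" if "t \<in> {0..1}" for t
  proof -
    have "((\<lambda>t. F A + \<beta> * t + \<gamma> * t^2) has_vector_derivative (\<beta> + 2 * \<gamma> * t)) (at t within cbox 0 1)"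
      unfolding has_real_derivative_iff_has_vector_derivative[symmetric]
      by (auto intro!: derivative_eq_intros)
    then show ?thesis
      by (rule has_vector_derivative_transform[rotated 2]) (use that \<phi> in auto)
  qed
  have u: "G (A + t *\<^sub>R (B - A)) \<bullet> (B - A) = \<beta> + 2 * \<gamma> * t" if "t \<in> {0..1}" for t
    by (rule vector_derivative_unique_within_closed_interval[OF _ _ d1 d2]) (use that in auto)
  have "F B - F A = \<beta> + \<gamma>" using \<phi>[of 1] by (simp add: \<phi>_def)
  moreover have "G A \<bullet> (B - A) = \<beta>" "G B \<bullet> (B - A) = \<beta> + 2 * \<gamma>" using u[of 0] u[of 1] by auto
  ultimately show ?thesis by (simp add: inner_add_left)
qed

text \<open>For \<open>X\<close> in the triangle, the trapezoid rule from each vertex \<open>V\<close> gives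
  \<open>2 F(X) = \<nabla>F(X) \<bullet> (X - V)\<close>. Averaging with the barycentric weights of \<open>X\<close> makes the right-hand side 0.\<close>

lemma triangle_vanish:
  assumes grad: "\<And>z. GDERIV F z :> G z"
    and quad: "quadratic_on (convex hull {A, B, C}) F"
    and zero: "\<And>V. V \<in> {A, B, C} \<Longrightarrow> F V = 0 \<and> G V = 0"
    and X: "X \<in> convex hull {A, B, C}"
  shows "F X = 0"
proof -
  have t: "2 * F X = G X \<bullet> (X - V)" if "V \<in> {A, B, C}" for V
    using quadratic_trapezoid[OF grad quad convex_convex_hull hull_inc[OF that] X] zero[OF that]
    by simp
  obtain p q r where w: "p + q + r = 1" "X = p *\<^sub>R A + q *\<^sub>R B + r *\<^sub>R C"
    using X unfolding convex_hull_3 by blast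
  have "p *\<^sub>R (X - A) + q *\<^sub>R (X - B) + r *\<^sub>R (X - C)
      = (p + q + r) *\<^sub>R X - (p *\<^sub>R A + q *\<^sub>R B + r *\<^sub>R C)"
    by (simp add: algebra_simps)
  also have "\<dots> = 0" unfolding w(1) w(2)[symmetric] by simp
  finally have "G X \<bullet> (p *\<^sub>R (X - A) + q *\<^sub>R (X - B) + r *\<^sub>R (X - C)) = 0" by simp
  then have "p * (G X \<bullet> (X - A)) + q * (G X \<bullet> (X - B)) + r * (G X \<bullet> (X - C)) = 0"
    by (simp only: inner_add_right inner_scaleR_right)
  then have "p * (2 * F X) + q * (2 * F X) + r * (2 * F X) = 0"
    using t[of A] t[of B] t[of C] by simp
  then have "(p + q + r) * (2 * F X) = 0"
    by (simp only: distrib_right)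
  then show ?thesis using w(1) by simp
qed

lemma in_triangle:
  fixes A B C :: "real \<times> real"
  assumes "0 \<le> p" "0 \<le> q" "0 \<le> r" "p + q + r = 1"
    "x = p * fst A + q * fst B + r * fst C" "y = p * snd A + q * snd B + r * snd C"
  shows "(x, y) \<in> convex hull {A, B, C}"
proof -
  have "(x, y) = p *\<^sub>R A + q *\<^sub>R B + r *\<^sub>R C"
    using assms by (simp add: prod_eq_iff)
  then show ?thesis using assms unfolding convex_hull_3 by blast
qed

lemma cell_cover:
  assumes "x0 < x1" "y0 < y1" "x \<in> {x0..x1}" "y \<in> {y0..y1}"
  shows "\<exists>T\<in>cell_triangles x0 x1 y0 y1. (x, y) \<in> T"
proof -
  define X Y where XY: "X = (x - x0) / (x1 - x0)" "Y = (y - y0) / (y1 - y0)"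
  define z where "z = ((x0 + x1) / 2, (y0 + y1) / 2)"
  have X: "0 \<le> X" "X \<le> 1" "x = x0 + X * (x1 - x0)" and Y: "0 \<le> Y" "Y \<le> 1" "y = y0 + Y * (y1 - y0)"
    using assms by (auto simp: XY)
  consider "Y \<le> X" "X + Y \<le> 1" | "Y \<le> X" "X + Y \<ge> 1" | "Y \<ge> X" "X + Y \<ge> 1" | "Y \<ge> X" "X + Y \<le> 1"
    by linarith
  then show ?thesis
  proof cases
    case 1
    have "(x, y) \<in> convex hull {z, (x0, y0), (x1, y0)}"
      by (rule in_triangle[where p = "2 * Y" and q = "1 - X - Y" and r = "X - Y"])
        (use 1 X Y in \<open>auto simp: z_def field_simps\<close>)
    then show ?thesis unfolding cell_triangles_def z_def Let_def by blast
  next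
    case 2
    have "(x, y) \<in> convex hull {z, (x1, y0), (x1, y1)}"
      by (rule in_triangle[where p = "2 * (1 - X)" and q = "X - Y" and r = "X + Y - 1"])
        (use 2 X Y in \<open>auto simp: z_def field_simps\<close>)
    then show ?thesis unfolding cell_triangles_def z_def Let_def by blast
  next
    case 3
    have "(x, y) \<in> convex hull {z, (x1, y1), (x0, y1)}"
      by (rule in_triangle[where p = "2 * (1 - Y)" and q = "X + Y - 1" and r = "Y - X"])
        (use 3 X Y in \<open>auto simp: z_def field_simps\<close>)
    then show ?thesis unfolding cell_triangles_def z_def Let_def by blast
  next
    case 4
    have "(x, y) \<in> convex hull {z, (x0, y1), (x0, y0)}"
      by (rule in_triangle[where p = "2 * X" and q = "Y - X" and r = "1 - X - Y"])
        (use 4 X Y in \<open>auto simp: z_def field_simps\<close>)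
    then show ?thesis unfolding cell_triangles_def z_def Let_def by blast
  qed
qed

text \<open>Each edge of a cell is an edge of one of its triangles; one horizontal and one vertical edge
  of every cell suffice to reach all grid edges that end at an inner grid point.\<close>

lemma cell_edges:
  assumes grad: "\<And>z. GDERIV F z :> G z"
    and quad: "\<And>T. T \<in> cell_triangles x0 x1 y0 y1 \<Longrightarrow> quadratic_on T F"
  shows "2 * (F (x1, y0) - F (x0, y0)) = (fst (G (x0, y0)) + fst (G (x1, y0))) * (x1 - x0)"
    and "2 * (F (x0, y1) - F (x0, y0)) = (snd (G (x0, y0)) + snd (G (x0, y1))) * (y1 - y0)"
proof -
  define z where "z = ((x0 + x1) / 2, (y0 + y1) / 2)"
  have e: "F B - F A = (G A + G B) \<bullet> (B - A) / 2"
    if "convex hull {z, A', B'} \<in> cell_triangles x0 x1 y0 y1" "{A, B} \<subseteq> {A', B'}" for A B A' B'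
    by (rule quadratic_trapezoid[OF grad quad[OF that(1)]])
      (use that(2) in \<open>auto intro: hull_inc\<close>)
  show "2 * (F (x1, y0) - F (x0, y0)) = (fst (G (x0, y0)) + fst (G (x1, y0))) * (x1 - x0)"
    using e[of "(x0, y0)" "(x1, y0)" "(x0, y0)" "(x1, y0)"]
    by (simp add: cell_triangles_def z_def Let_def inner_prod_def)
  show "2 * (F (x0, y1) - F (x0, y0)) = (snd (G (x0, y0)) + snd (G (x0, y1))) * (y1 - y0)"
    using e[of "(x0, y1)" "(x0, y0)" "(x0, y0)" "(x0, y1)"]
    by (simp add: cell_triangles_def z_def Let_def inner_prod_def)
qed

text \<open>With zero data at the corners, the trapezoid rule from the corners to the centre \<open>z\<close>
  expresses \<open>2 F(z)\<close> by \<open>\<nabla>F(z)\<close> in directions that come in opposite pairs, so \<open>F(z)\<close> and then \<open>\<nabla>F(z)\<close>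
  are 0, and the lemma on triangles applies.\<close>

lemma cell_vanish:
  assumes grad: "\<And>z. GDERIV F z :> G z"
    and quad: "\<And>T. T \<in> cell_triangles x0 x1 y0 y1 \<Longrightarrow> quadratic_on T F"
    and lt: "x0 < x1" "y0 < y1"
    and zero: "\<And>V. V \<in> {x0, x1} \<times> {y0, y1} \<Longrightarrow> F V = 0 \<and> G V = 0"
    and X: "x \<in> {x0..x1}" "y \<in> {y0..y1}"
  shows "F (x, y) = 0"
proof -
  define z where "z = ((x0 + x1) / 2, (y0 + y1) / 2)"
  have T: "\<exists>A\<in>{x0, x1} \<times> {y0, y1}. \<exists>B\<in>{x0, x1} \<times> {y0, y1}. T = convex hull {z, A, B}"
    if "T \<in> cell_triangles x0 x1 y0 y1" for T
    using that unfolding cell_triangles_def Let_def z_def[symmetric] insert_iff empty_iff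
    by (elim disjE FalseE; hypsubst) (rule bexI, rule bexI, rule refl, simp, simp)+
  have e: "2 * F z = G z \<bullet> (z - A)"
    if "A \<in> {A', B'}" "convex hull {z, A', B'} \<in> cell_triangles x0 x1 y0 y1"
      "A \<in> {x0, x1} \<times> {y0, y1}" for A A' B'
    using quadratic_trapezoid[OF grad quad[OF that(2)] convex_convex_hull, of A z] zero[OF that(3)] that(1)
    by (simp add: hull_inc)
  have e1: "2 * F z = G z \<bullet> (z - (x0, y0))" "2 * F z = G z \<bullet> (z - (x1, y0))"
    by (rule e[where A' = "(x0, y0)" and B' = "(x1, y0)"];
        simp add: cell_triangles_def Let_def z_def)+
  have e2: "2 * F z = G z \<bullet> (z - (x1, y1))" "2 * F z = G z \<bullet> (z - (x0, y1))"
    by (rule e[where A' = "(x1, y1)" and B' = "(x0, y1)"];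
        simp add: cell_triangles_def Let_def z_def)+
  \<comment> \<open>Three of the four corners determine the three unknowns \<open>F z\<close>, \<open>g1\<close>, \<open>g2\<close>.\<close>
  obtain g1 g2 where g: "G z = (g1, g2)" by fastforce
  have zd: "z - (x0, y0) = ((x1 - x0) / 2, (y1 - y0) / 2)" "z - (x1, y0) = (- ((x1 - x0) / 2), (y1 - y0) / 2)"
    "z - (x1, y1) = (- ((x1 - x0) / 2), - ((y1 - y0) / 2))"
    by (simp_all add: z_def field_simps)
  have "2 * F z = g1 * (x1 - x0) / 2 + g2 * (y1 - y0) / 2"
    using e1(1) unfolding zd g by simp
  moreover have "2 * F z = - (g1 * (x1 - x0) / 2) + g2 * (y1 - y0) / 2"
    using e1(2) unfolding zd g by simp
  moreover have "2 * F z = - (g1 * (x1 - x0) / 2) - g2 * (y1 - y0) / 2"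
    using e2(1) unfolding zd g by simp
  ultimately have "F z = 0" "g1 * (x1 - x0) = 0" "g2 * (y1 - y0) = 0" by linarith+
  then have z0: "F z = 0 \<and> G z = 0" using lt by (auto simp: g zero_prod_def)
  obtain T where T': "T \<in> cell_triangles x0 x1 y0 y1" "(x, y) \<in> T"
    using cell_cover[OF lt X] by blast
  then obtain A B where AB: "T = convex hull {z, A, B}" "A \<in> {x0, x1} \<times> {y0, y1}" "B \<in> {x0, x1} \<times> {y0, y1}"
    using T by blast
  show ?thesis
    by (rule triangle_vanish[OF grad, of z A B]) (use quad T' AB zero z0 in auto)
qed

text \<open>The data at a grid point on the boundary of the support come from the outside by continuity.\<close>

lemma vanish_closure:
  assumes grad: "\<And>z. GDERIV F z :> G z" and cont: "continuous_on UNIV G"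
    and "open S" and zero: "\<And>z. z \<in> S \<Longrightarrow> F z = 0" and g: "g \<in> closure S"
  shows "F g = 0 \<and> G g = 0"
proof -
  have "continuous_on UNIV F"
    by (metis grad gderiv_def has_derivative_continuous continuous_at_imp_continuous_on)
  then have "closed {z. F z = 0}" by (intro closed_Collect_eq) auto
  moreover have "closed {z. G z = 0}" using cont by (intro closed_Collect_eq) auto
  moreover have "S \<subseteq> {z. G z = 0}"
  proof
    fix z assume z: "z \<in> S"
    have "(F has_derivative (\<lambda>h. 0)) (at z)"
      by (rule has_derivative_transform_within_open[OF has_derivative_const[of 0] \<open>open S\<close> z])
        (use zero in auto)
    then have "(\<lambda>h. 0) = (\<lambda>h. h \<bullet> G z)"
      using has_derivative_unique grad[of z] gderiv_def by metis
    then have "G z \<bullet> G z = 0" by metis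
    then show "z \<in> {z. G z = 0}" by simp
  qed
  moreover have "S \<subseteq> {z. F z = 0}" using zero by blast
  ultimately show ?thesis using g closure_minimal by blast
qed

lemma quadratic_on_lincomb:
  assumes "quadratic_on T F" "quadratic_on T H"
  shows "quadratic_on T (\<lambda>z. a * F z + b * H z)"
proof -
  obtain c0 c1 c2 c3 c4 c5 where c: "\<And>x y. (x, y) \<in> T \<Longrightarrow>
      F (x, y) = c0 + c1 * x + c2 * y + c3 * x^2 + c4 * x * y + c5 * y^2"
    using assms(1) unfolding quadratic_on_def by blast
  obtain d0 d1 d2 d3 d4 d5 where d: "\<And>x y. (x, y) \<in> T \<Longrightarrow>
      H (x, y) = d0 + d1 * x + d2 * y + d3 * x^2 + d4 * x * y + d5 * y^2"
    using assms(2) unfolding quadratic_on_def by blast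
  have "\<forall>x y. (x, y) \<in> T \<longrightarrow> a * F (x, y) + b * H (x, y) =
      (a * c0 + b * d0) + (a * c1 + b * d1) * x + (a * c2 + b * d2) * y + (a * c3 + b * d3) * x^2
      + (a * c4 + b * d4) * x * y + (a * c5 + b * d5) * y^2"
    using c d by (auto simp: algebra_simps)
  then show ?thesis unfolding quadratic_on_def by blast
qed

text \<open>The trapezoid rule along two collinear grid edges that lead from a point with value \<open>f\<close> and
  directional derivative \<open>p\<close> to two points where both are zero.\<close>

lemma two_edges_vanish:
  fixes f p h k :: real
  assumes "0 < h" "0 < k" "2 * f = p * h" "- 2 * f = p * k"
  shows "f = 0 \<and> p = 0"
proof -
  have "p * (h + k) = 0" using assms(3,4) by (simp add: algebra_simps)
  then have "p = 0" using assms(1,2) by simp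
  then show ?thesis using assms(3) by simp
qed

lemma octagon_subset_box:
  fixes u v :: "int \<Rightarrow> real"
  assumes "strict_mono_on {i-2..i+1} u" "strict_mono_on {j-2..j+1} v"
  shows "octagon u v i j \<subseteq> {u (i-2)..u (i+1)} \<times> {v (j-2)..v (j+1)}"
proof -
  have s: "u (i-2) \<le> u (i-1)" "u (i-1) \<le> u i" "u i \<le> u (i+1)" "v (j-2) \<le> v (j-1)" "v (j-1) \<le> v j" "v j \<le> v (j+1)"
    by (rule strict_mono_on_leD[OF assms(1)] strict_mono_on_leD[OF assms(2)]; simp)+
  show ?thesis unfolding octagon_def
    by (rule hull_minimal) (use s in \<open>auto intro: convex_Times\<close>)
qed

text \<open>The box has only four inner grid points. At \<open>(u\<^sub>i, v\<^sub>j)\<close> the value is 0, so the edges to the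
  boundary of the box give a zero gradient. Each of the other three lies, in one coordinate
  direction, between two points with zero data, and has an edge to such a point in the other direction.
  Hence the data vanish at all grid points and \<open>F\<close> vanishes cell by cell.\<close>

lemma box_supported_spline_zero:
  fixes u v :: "int \<Rightarrow> real"
  assumes su: "strict_mono_on {i-2..i+1} u" and sv: "strict_mono_on {j-2..j+1} v"
    and C1: "C1_plane F"
    and quad: "\<And>k l T. k \<in> {i-1..i+1} \<Longrightarrow> l \<in> {j-1..j+1} \<Longrightarrow>
      T \<in> cell_triangles (u (k-1)) (u k) (v (l-1)) (v l) \<Longrightarrow> quadratic_on T F"
    and out: "\<And>z. z \<notin> {u (i-2)..u (i+1)} \<times> {v (j-2)..v (j+1)} \<Longrightarrow> F z = 0"
    and zero: "F (u i, v j) = 0"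
  shows "F = (\<lambda>z. 0)"
proof -
  obtain G where cont: "continuous_on UNIV G" and grad: "\<And>z. GDERIV F z :> G z"
    using C1 unfolding C1_plane_def by blast
  have uv: "u (i-2) < u (i-1)" "u (i-1) < u i" "u i < u (i+1)" "v (j-2) < v (j-1)" "v (j-1) < v j" "v j < v (j+1)"
    by (rule strict_mono_onD[OF su] strict_mono_onD[OF sv]; simp)+
  let ?N = "\<lambda>x y. F (x, y) = 0 \<and> G (x, y) = 0"
  have c1: "(a, y) \<in> closure ({..<a} \<times> UNIV)" "(a, y) \<in> closure ({a<..} \<times> UNIV)"
      "(y, a) \<in> closure (UNIV \<times> {..<a})" "(y, a) \<in> closure (UNIV \<times> {a<..})" for a y :: real
    by (simp_all add: closure_Times)
  have b: "?N (u (i-2)) y" "?N (u (i+1)) y" "?N y (v (j-2))" "?N y (v (j+1))" for y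
    by (rule vanish_closure[OF grad cont _ _ c1(1)] vanish_closure[OF grad cont _ _ c1(2)]
          vanish_closure[OF grad cont _ _ c1(3)] vanish_closure[OF grad cont _ _ c1(4)];
        force intro: open_Times out)+
  have E: "2 * (F (u k, v (l-1)) - F (u (k-1), v (l-1)))
      = (fst (G (u (k-1), v (l-1))) + fst (G (u k, v (l-1)))) * (u k - u (k-1))"
    "2 * (F (u (k-1), v l) - F (u (k-1), v (l-1)))
      = (snd (G (u (k-1), v (l-1))) + snd (G (u (k-1), v l))) * (v l - v (l-1))"
    if "k \<in> {i-1..i+1}" "l \<in> {j-1..j+1}" for k l
    by (rule cell_edges[OF grad quad[OF that]]; assumption)+
  have fg: "G z = 0 \<longleftrightarrow> fst (G z) = 0 \<and> snd (G z) = 0" for z by (simp add: prod_eq_iff)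
  have n1: "?N (u i) (v j)"
    using E(1)[of "i+1" "j+1"] E(2)[of "i+1" "j+1"] b uv zero by (simp add: fg)
  have n2: "?N (u (i-1)) (v j)"
  proof -
    have "F (u (i-1), v j) = 0 \<and> fst (G (u (i-1), v j)) = 0"
      by (rule two_edges_vanish[of "u (i-1) - u (i-2)" "u i - u (i-1)"])
        (use E(1)[of "i-1" "j+1"] E(1)[of "i" "j+1"] b uv n1 in \<open>simp_all\<close>)
    then show ?thesis
      using E(2)[of "i" "j+1"] b uv by (simp add: fg)
  qed
  have n3: "?N (u i) (v (j-1))"
  proof -
    have "F (u i, v (j-1)) = 0 \<and> snd (G (u i, v (j-1))) = 0"
      by (rule two_edges_vanish[of "v (j-1) - v (j-2)" "v j - v (j-1)"])
        (use E(2)[of "i+1" "j-1"] E(2)[of "i+1" "j"] b uv n1 in \<open>simp_all\<close>)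
    then show ?thesis
      using E(1)[of "i+1" "j"] b uv by (simp add: fg)
  qed
  have n4: "?N (u (i-1)) (v (j-1))"
  proof -
    have "F (u (i-1), v (j-1)) = 0 \<and> fst (G (u (i-1), v (j-1))) = 0"
      by (rule two_edges_vanish[of "u (i-1) - u (i-2)" "u i - u (i-1)"])
        (use E(1)[of "i-1" "j"] E(1)[of "i" "j"] b uv n3 in \<open>simp_all\<close>)
    then show ?thesis
      using E(2)[of "i" "j"] b uv n2 by (simp add: fg)
  qed
  have N: "?N (u k) (v l)" if "k \<in> {i-2..i+1}" "l \<in> {j-2..j+1}" for k l
  proof -
    have "k = i-2 \<or> k = i-1 \<or> k = i \<or> k = i+1" "l = j-2 \<or> l = j-1 \<or> l = j \<or> l = j+1"
      using that by auto
    then show ?thesis using b n1 n2 n3 n4 by blast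
  qed
  have cell: "F (x, y) = 0" if k: "k \<in> {i-1..i+1}" "l \<in> {j-1..j+1}"
    and x: "x \<in> {u (k-1)..u k}" "y \<in> {v (l-1)..v l}" for k l x y
  proof -
    have lt: "u (k-1) < u k" "v (l-1) < v l"
      using k by (auto intro: strict_mono_onD[OF su] strict_mono_onD[OF sv])
    show ?thesis
      by (rule cell_vanish[OF grad quad[OF k] lt _ x]) (use N k in auto)
  qed
  have "F (x, y) = 0" for x y
  proof (cases "x \<in> {u (i-2)..u (i+1)} \<and> y \<in> {v (j-2)..v (j+1)}")
    case False
    then show ?thesis by (intro out) auto
  next
    case True
    have "\<exists>k\<in>{i-1..i+1}. x \<in> {u (k-1)..u k}"
    proof -
      have "x \<in> {u (i-1-1)..u (i-1)} \<or> x \<in> {u (i-1)..u i} \<or> x \<in> {u (i+1-1)..u (i+1)}"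
        using True by auto
      moreover have "i-1 \<in> {i-1..i+1}" "i \<in> {i-1..i+1}" "i+1 \<in> {i-1..i+1}" by auto
      ultimately show ?thesis by blast
    qed
    moreover have "\<exists>l\<in>{j-1..j+1}. y \<in> {v (l-1)..v l}"
    proof -
      have "y \<in> {v (j-1-1)..v (j-1)} \<or> y \<in> {v (j-1)..v j} \<or> y \<in> {v (j+1-1)..v (j+1)}"
        using True by auto
      moreover have "j-1 \<in> {j-1..j+1}" "j \<in> {j-1..j+1}" "j+1 \<in> {j-1..j+1}" by auto
      ultimately show ?thesis by blast
    qed
    ultimately show ?thesis using cell by blast
  qed
  then show ?thesis by auto
qed

lemma classical_bspline_unique:
  assumes su: "strict_mono_on {-2..m+2} u" and sv: "strict_mono_on {-2..n+2} v"
    and ij: "i \<in> {0..m+1}" "j \<in> {0..n+1}"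
    and F: "is_classical_bspline m n u v i j F" and H: "is_classical_bspline m n u v i j H"
  shows "F = H"
proof -
  let ?D = "\<lambda>z. F z - H z"
  have su': "strict_mono_on {i-2..i+1} u" and sv': "strict_mono_on {j-2..j+1} v"
    using ij by (auto intro: monotone_on_subset[OF su] monotone_on_subset[OF sv])
  have "?D = (\<lambda>z. 0)"
  proof (rule box_supported_spline_zero[OF su' sv'])
    obtain G G' where "continuous_on UNIV G" "\<And>z. GDERIV F z :> G z"
      "continuous_on UNIV G'" "\<And>z. GDERIV H z :> G' z"
      using F H unfolding is_classical_bspline_def C1_plane_def by blast
    then show "C1_plane ?D" unfolding C1_plane_def
      by (intro exI[of _ "\<lambda>z. G z - G' z"]) (auto intro!: continuous_intros GDERIV_diff)
  next
    fix k l T assume "k \<in> {i-1..i+1}" "l \<in> {j-1..j+1}"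
      "T \<in> cell_triangles (u (k-1)) (u k) (v (l-1)) (v l)"
    then have "T \<in> crisscross m n u v" using ij unfolding crisscross_def by force
    then show "quadratic_on T ?D"
      using F H quadratic_on_lincomb[of T F H 1 "-1"] unfolding is_classical_bspline_def by simp
  next
    fix z assume "z \<notin> {u (i-2)..u (i+1)} \<times> {v (j-2)..v (j+1)}"
    then have "z \<notin> octagon u v i j" using octagon_subset_box[OF su' sv'] by blast
    then have "F z = 0" "H z = 0" using F H unfolding is_classical_bspline_def by blast+
    then show "?D z = 0" by simp
  next
    show "?D (u i, v j) = 0"
      using F H unfolding is_classical_bspline_def by simp
  qed
  then show ?thesis by (simp add: fun_eq_iff)
qed

section \<open>The criss-cross Hermite interpolant of a product on one cell\<close>

definition pos_sq :: "real \<Rightarrow> real" where "pos_sq w = (max 0 w)^2"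

lemma pos_sq_nonneg: "0 \<le> pos_sq w" by (simp add: pos_sq_def)

text \<open>The truncated square is once but not twice differentiable at 0; this is what creates splines of
  smoothness \<open>C\<^sup>1\<close> across the diagonals.\<close>

lemma DERIV_pos_sq: "(pos_sq has_real_derivative 2 * max 0 w) (at w)"
proof -
  consider "w < 0" | "w = 0" | "w > 0" by linarith
  then show ?thesis
  proof cases
    case 1
    have "((\<lambda>w. 0) has_real_derivative 2 * max 0 w) (at w)" using 1 by auto
    then show ?thesis
      by (rule has_field_derivative_transform_within_open[where S = "{..<0}"])
        (use 1 in \<open>auto simp: pos_sq_def\<close>)
  next
    case 2
    have "(\<lambda>h. (pos_sq (0 + h) - pos_sq 0) / h) = (\<lambda>h. max 0 h)"
      by (auto simp: pos_sq_def max_def power2_eq_square)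
    moreover have "(\<lambda>h::real. max 0 h) \<midarrow>0\<rightarrow> max 0 0" by (intro tendsto_intros)
    ultimately show ?thesis by (simp add: 2 DERIV_def)
  next
    case 3
    have "((\<lambda>w. w^2) has_real_derivative 2 * max 0 w) (at w)"
      using 3 by (auto intro!: derivative_eq_intros)
    then show ?thesis
      by (rule has_field_derivative_transform_within_open[where S = "{0<..}"])
        (use 3 in \<open>auto simp: pos_sq_def\<close>)
  qed
qed

lemma has_derivative_pos_sq [derivative_intros]:
  assumes "(g has_derivative g') (at z within S)"
  shows "((\<lambda>z. pos_sq (g z)) has_derivative (\<lambda>h. 2 * max 0 (g z) * g' h)) (at z within S)"
  using has_derivative_compose[OF assms DERIV_pos_sq[unfolded has_field_derivative_def]]
  by simp

text \<open>In local coordinates on the unit square the Bernstein polynomials are \<open>(1 - X)\<^sup>2\<close>, \<open>2X(1 - X)\<close>,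
  \<open>X\<^sup>2\<close>. The function \<open>patch\<close> is the \<open>C\<^sup>1\<close> quadratic spline on the square split by its diagonals that has the
  same values and gradients at the four corners as the product of the polynomials with Bernstein
  coefficients \<open>p\<close> and \<open>q\<close>. The squares truncated along the diagonals interpolate the products of two outer
  Bernstein polynomials. The product of the two middle ones vanishes at the corners together with its
  gradient and contributes nothing. The other four terms follow because a function
  of one variable, which is already quadratic, must be reproduced.\<close>

definition patch :: "real \<Rightarrow> real \<Rightarrow> real \<Rightarrow> real \<Rightarrow> real \<Rightarrow> real \<Rightarrow> real \<Rightarrow> real \<Rightarrow> real" where
  "patch p0 p1 p2 q0 q1 q2 X Y =
    (let R1 = pos_sq (1 - X - Y); R2 = pos_sq (X + Y - 1); R3 = pos_sq (Y - X); R4 = pos_sq (X - Y) in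
      p0 * q0 * R1 + p2 * q2 * R2 + p0 * q2 * R3 + p2 * q0 * R4
      + p0 * q1 * ((1 - X)^2 - R1 - R3) + p2 * q1 * (X^2 - R2 - R4)
      + p1 * q0 * ((1 - Y)^2 - R1 - R4) + p1 * q2 * (Y^2 - R2 - R3))"

definition patch_dx :: "real \<Rightarrow> real \<Rightarrow> real \<Rightarrow> real \<Rightarrow> real \<Rightarrow> real \<Rightarrow> real \<Rightarrow> real \<Rightarrow> real" where
  "patch_dx p0 p1 p2 q0 q1 q2 X Y =
    2 * (let r1 = max 0 (1 - X - Y); r2 = max 0 (X + Y - 1); r3 = max 0 (Y - X); r4 = max 0 (X - Y) in
      - p0 * q0 * r1 + p2 * q2 * r2 - p0 * q2 * r3 + p2 * q0 * r4
      + p0 * q1 * (r1 + r3 - (1 - X)) + p2 * q1 * (X - r2 - r4)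
      + p1 * q0 * (r1 - r4) + p1 * q2 * (r3 - r2))"

lemma patch_swap: "patch p0 p1 p2 q0 q1 q2 X Y = patch q0 q1 q2 p0 p1 p2 Y X"
proof -
  have "1 - X - Y = 1 - Y - X" "X + Y - 1 = Y + X - 1" by simp_all
  then show ?thesis by (simp add: patch_def Let_def algebra_simps)
qed

lemma patch_linear:
  "patch p0 p1 p2 q0 q1 q2 X Y =
    p0 * patch 1 0 0 q0 q1 q2 X Y + p1 * patch 0 1 0 q0 q1 q2 X Y + p2 * patch 0 0 1 q0 q1 q2 X Y"
  by (simp add: patch_def Let_def algebra_simps)

lemma patch_one: "patch 1 1 1 1 1 1 X Y = 1"
proof -
  have "pos_sq w + pos_sq (- w) = w^2" for w by (simp add: pos_sq_def max_def power2_eq_square)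
  from this[of "X + Y - 1"] this[of "X - Y"]
  have e: "pos_sq (1 - X - Y) + pos_sq (X + Y - 1) = (X + Y - 1)^2" "pos_sq (X - Y) + pos_sq (Y - X) = (X - Y)^2"
    by (simp_all add: algebra_simps)
  have "patch 1 1 1 1 1 1 X Y = (1 - X)^2 + X^2 + (1 - Y)^2 + Y^2
      - (pos_sq (1 - X - Y) + pos_sq (X + Y - 1)) - (pos_sq (X - Y) + pos_sq (Y - X))"
    by (simp add: patch_def Let_def)
  also have "\<dots> = 1" unfolding e by (simp add: power2_eq_square algebra_simps)
  finally show ?thesis .
qed

lemma pos_sq_add_le:
  assumes "a + b \<le> c" "a \<le> c" "b \<le> c" "0 \<le> c"
  shows "pos_sq a + pos_sq b \<le> c^2"
proof -
  have "pos_sq a + pos_sq b \<le> (max 0 a + max 0 b)^2"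
    by (simp add: pos_sq_def power2_sum)
  also have "\<dots> \<le> c^2" by (rule power_mono) (use assms in auto)
  finally show ?thesis .
qed

text \<open>Each of the eight basis functions is nonnegative. For a difference such as
  \<open>(1 - X)\<^sup>2 - R\<^sub>1 - R\<^sub>3\<close> the arguments \<open>1 - X - Y\<close> and \<open>Y - X\<close> of the truncated squares, and also their sum
  \<open>1 - 2X\<close>, are at most \<open>1 - X\<close>.\<close>

lemma patch_nonneg:
  assumes "0 \<le> p0" "0 \<le> p1" "0 \<le> p2" "0 \<le> q0" "0 \<le> q1" "0 \<le> q2"
    and XY: "0 \<le> X" "X \<le> 1" "0 \<le> Y" "Y \<le> 1"
  shows "0 \<le> patch p0 p1 p2 q0 q1 q2 X Y"
proof -
  have "pos_sq (1 - X - Y) + pos_sq (Y - X) \<le> (1 - X)^2" "pos_sq (X + Y - 1) + pos_sq (X - Y) \<le> X^2"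
    "pos_sq (1 - X - Y) + pos_sq (X - Y) \<le> (1 - Y)^2" "pos_sq (X + Y - 1) + pos_sq (Y - X) \<le> Y^2"
    by (rule pos_sq_add_le; use XY in simp)+
  then show ?thesis unfolding patch_def Let_def using assms pos_sq_nonneg
    by (intro add_nonneg_nonneg mult_nonneg_nonneg) auto
qed

text \<open>On an edge the interpolant agrees with the product itself, and its normal derivative is linear:
  both are determined by coefficients at that edge and by the other factor.\<close>

lemma patch_0:
  assumes "0 \<le> Y" "Y \<le> 1"
  shows "patch p0 p1 p2 q0 q1 q2 0 Y = p0 * (q0 * (1 - Y)^2 + q1 * (2 * Y * (1 - Y)) + q2 * Y^2)"
    and "patch_dx p0 p1 p2 q0 q1 q2 0 Y = 2 * (p1 - p0) * (q0 * (1 - Y) + q2 * Y)"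
    and "patch_dx q0 q1 q2 p0 p1 p2 Y 0 = 2 * p0 * ((q1 - q0) * (1 - Y) + (q2 - q1) * Y)"
  using assms by (simp_all add: patch_def patch_dx_def Let_def pos_sq_def max_def)
    (auto simp: algebra_simps power2_eq_square)

lemma patch_1:
  assumes "0 \<le> Y" "Y \<le> 1"
  shows "patch p0 p1 p2 q0 q1 q2 1 Y = p2 * (q0 * (1 - Y)^2 + q1 * (2 * Y * (1 - Y)) + q2 * Y^2)"
    and "patch_dx p0 p1 p2 q0 q1 q2 1 Y = 2 * (p2 - p1) * (q0 * (1 - Y) + q2 * Y)"
    and "patch_dx q0 q1 q2 p0 p1 p2 Y 1 = 2 * p2 * ((q1 - q0) * (1 - Y) + (q2 - q1) * Y)"
  using assms by (simp_all add: patch_def patch_dx_def Let_def pos_sq_def max_def)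
    (auto simp: algebra_simps power2_eq_square)

lemma patch_has_derivative:
  assumes "(f has_derivative f') (at z within S)" "(g has_derivative g') (at z within S)"
  shows "((\<lambda>z. patch p0 p1 p2 q0 q1 q2 (f z) (g z)) has_derivative
    (\<lambda>h. patch_dx p0 p1 p2 q0 q1 q2 (f z) (g z) * f' h + patch_dx q0 q1 q2 p0 p1 p2 (g z) (f z) * g' h))
    (at z within S)"
proof -
  have e: "1 - Y - X = 1 - X - Y" "Y + X - 1 = X + Y - 1" for X Y :: real by simp_all
  show ?thesis unfolding patch_def Let_def
    by (rule derivative_eq_intros assms refl)+
      (simp add: fun_eq_iff patch_dx_def Let_def e algebra_simps power2_eq_square)
qed

lemma continuous_patch_dx [continuous_intros]:
  assumes "continuous_on S f" "continuous_on S g"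
  shows "continuous_on S (\<lambda>z. patch_dx p0 p1 p2 q0 q1 q2 (f z) (g z))"
  unfolding patch_dx_def Let_def by (intro continuous_intros assms)

section \<open>Gluing the patches to a continuously differentiable spline\<close>

text \<open>Bi-infinite unbounded knot sequences make the cells cover the whole plane, so the spline needs
  no separate treatment outside the grid.\<close>

definition full_knots :: "(int \<Rightarrow> real) \<Rightarrow> bool" where
  "full_knots U \<longleftrightarrow> strict_mono U \<and> (\<forall>x. \<exists>k. U (k-1) \<le> x \<and> x < U k)"

lemma full_knots_less: "full_knots U \<Longrightarrow> i < j \<Longrightarrow> U i < U j"
  by (simp add: full_knots_def strict_mono_def)

lemma extend_knots:
  assumes u: "strict_mono_on {-2..m+2} u" and m: "1 \<le> m"
  shows "\<exists>U. full_knots U \<and> (\<forall>k\<in>{-2..m+2}. U k = u k)"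
proof -
  define U where "U = (\<lambda>k. if k < -2 then u (-2) + of_int (k+2)
    else if k > m+2 then u (m+2) + of_int (k-m-2) else u k)"
  have le: "u (-2) \<le> u k" "u k \<le> u (m+2)" if "-2 \<le> k" "k \<le> m+2" for k
    by (rule strict_mono_on_leD[OF u]; use that m in simp)+
  have mono: "U i < U j" if ij: "i < j" for i j
  proof -
    have uu: "u i < u j" if "-2 \<le> i" "j \<le> m+2"
      using ij that by (intro strict_mono_onD[OF u]) auto
    show ?thesis
      unfolding U_def using ij m uu le[of i] le[of j] le[of "-2"] by (auto simp: not_less; linarith)
  qed
  have "\<exists>k. U (k-1) \<le> x \<and> x < U k" for x
  proof -
    \<comment> \<open>Explicit indices, in the two linear tails, whose knots enclose \<open>x\<close>.\<close>
    define N where "N = min (-3) (\<lfloor>x - u (-2)\<rfloor> - 2)"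
    define M where "M = max (m+3) (\<lfloor>x - u (m+2)\<rfloor> + m + 3)"
    have N: "U N \<le> x"
    proof -
      have "of_int N \<le> x - u (-2) - 2" unfolding N_def by linarith
      moreover have "N < -2" by (simp add: N_def)
      ultimately show ?thesis unfolding U_def by simp
    qed
    have M: "x < U M"
    proof -
      have "x - u (m+2) < of_int (M - m - 2)" unfolding M_def by linarith
      moreover have "m + 2 < M" by (simp add: M_def)
      ultimately show ?thesis unfolding U_def using m by simp
    qed
    have fin: "finite {k \<in> {N<..M}. x < U k}" by (rule finite_subset[of _ "{N<..M}"]) auto
    define k where "k = Min {k \<in> {N<..M}. x < U k}"
    have "N < M" unfolding N_def M_def using m by auto
    then have "{k \<in> {N<..M}. x < U k} \<noteq> {}" using M by auto
    then have k: "k \<in> {k \<in> {N<..M}. x < U k}" unfolding k_def using fin by (rule Min_in[rotated])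
    have "U (k-1) \<le> x"
    proof (rule ccontr)
      assume "\<not> U (k-1) \<le> x"
      then have "k - 1 \<noteq> N" "x < U (k-1)" using N by auto
      then have "k - 1 \<in> {k \<in> {N<..M}. x < U k}" using k by auto
      then have "k \<le> k - 1" unfolding k_def using fin by (rule Min_le[rotated])
      then show False by simp
    qed
    then show ?thesis using k by auto
  qed
  then have "full_knots U" using mono unfolding full_knots_def by (auto intro!: strict_monoI)
  moreover have "U k = u k" if "k \<in> {-2..m+2}" for k using that by (auto simp: U_def)
  ultimately show ?thesis by blast
qed

text \<open>For control coefficients \<open>d\<close> of a univariate quadratic \<open>C\<^sup>1\<close> spline, with \<open>d\<^sub>k\<close> the middle Bernstein
  coefficient on \<open>[U\<^sub>k\<^sub>-\<^sub>1, U\<^sub>k]\<close>, this is the value at \<open>U\<^sub>k\<close>: the point on the segment from \<open>d\<^sub>k\<close> to \<open>d\<^sub>k\<^sub>+\<^sub>1\<close>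
  for which the one-sided derivatives agree.\<close>

definition knot_value :: "(int \<Rightarrow> real) \<Rightarrow> (int \<Rightarrow> real) \<Rightarrow> int \<Rightarrow> real" where
  "knot_value U d k = ((U (k+1) - U k) * d k + (U k - U (k-1)) * d (k+1)) / (U (k+1) - U (k-1))"

definition local_coord :: "(int \<Rightarrow> real) \<Rightarrow> int \<Rightarrow> real \<Rightarrow> real" where
  "local_coord U k x = (x - U (k-1)) / (U k - U (k-1))"

definition cell_spline :: "(int \<Rightarrow> real) \<Rightarrow> (int \<Rightarrow> real) \<Rightarrow> (int \<Rightarrow> real) \<Rightarrow> (int \<Rightarrow> real) \<Rightarrow>
    int \<Rightarrow> int \<Rightarrow> real \<Rightarrow> real \<Rightarrow> real" where
  "cell_spline U V d e k l x y =
    patch (knot_value U d (k-1)) (d k) (knot_value U d k) (knot_value V e (l-1)) (e l) (knot_value V e l)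
      (local_coord U k x) (local_coord V l y)"

text \<open>The derivative in the second variable is obtained by exchanging the roles of the variables,
  which keeps all matching statements symmetric.\<close>

definition cell_dx :: "(int \<Rightarrow> real) \<Rightarrow> (int \<Rightarrow> real) \<Rightarrow> (int \<Rightarrow> real) \<Rightarrow> (int \<Rightarrow> real) \<Rightarrow>
    int \<Rightarrow> int \<Rightarrow> real \<Rightarrow> real \<Rightarrow> real" where
  "cell_dx U V d e k l x y =
    patch_dx (knot_value U d (k-1)) (d k) (knot_value U d k) (knot_value V e (l-1)) (e l) (knot_value V e l)
      (local_coord U k x) (local_coord V l y) / (U k - U (k-1))"

definition cell_jet :: "(int \<Rightarrow> real) \<Rightarrow> (int \<Rightarrow> real) \<Rightarrow> (int \<Rightarrow> real) \<Rightarrow> (int \<Rightarrow> real) \<Rightarrow>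
    int \<Rightarrow> int \<Rightarrow> real \<Rightarrow> real \<Rightarrow> real \<times> real \<times> real" where
  "cell_jet U V d e k l x y =
    (cell_spline U V d e k l x y, cell_dx U V d e k l x y, cell_dx V U e d l k y x)"

definition cell_index :: "(int \<Rightarrow> real) \<Rightarrow> real \<Rightarrow> int" where
  "cell_index U x = (SOME k. U (k-1) \<le> x \<and> x < U k)"

definition spline :: "(int \<Rightarrow> real) \<Rightarrow> (int \<Rightarrow> real) \<Rightarrow> (int \<Rightarrow> real) \<Rightarrow> (int \<Rightarrow> real) \<Rightarrow>
    real \<times> real \<Rightarrow> real" where
  "spline U V d e z = cell_spline U V d e (cell_index U (fst z)) (cell_index V (snd z)) (fst z) (snd z)"

definition spline_grad :: "(int \<Rightarrow> real) \<Rightarrow> (int \<Rightarrow> real) \<Rightarrow> (int \<Rightarrow> real) \<Rightarrow> (int \<Rightarrow> real) \<Rightarrow>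
    real \<times> real \<Rightarrow> real \<times> real" where
  "spline_grad U V d e z = snd (cell_jet U V d e (cell_index U (fst z)) (cell_index V (snd z)) (fst z) (snd z))"

lemma cell_spline_swap: "cell_spline U V d e k l x y = cell_spline V U e d l k y x"
  unfolding cell_spline_def by (rule patch_swap)

lemma cell_jet_swap:
  "cell_jet U V d e k l x y = (let (f, g, h) = cell_jet V U e d l k y x in (f, h, g))"
  by (simp add: cell_jet_def cell_spline_swap[of U V])

lemma cell_index_bounds:
  assumes "full_knots U"
  shows "U (cell_index U x - 1) \<le> x" "x < U (cell_index U x)"
proof -
  have "\<exists>k. U (k-1) \<le> x \<and> x < U k" using assms by (simp add: full_knots_def)
  from someI_ex[OF this] show "U (cell_index U x - 1) \<le> x" "x < U (cell_index U x)" by (auto simp: cell_index_def)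
qed

lemma local_coord_bounds:
  assumes "full_knots U" "x \<in> {U (k-1)..U k}"
  shows "0 \<le> local_coord U k x" "local_coord U k x \<le> 1"
  using full_knots_less[OF assms(1), of "k-1" k] assms(2) by (auto simp: local_coord_def)

text \<open>Up to a factor 2, both sides are one-sided derivatives of the univariate spline at \<open>U\<^sub>k\<close>.\<close>

lemma knot_value_slope:
  assumes "full_knots U"
  shows "(knot_value U d k - d k) / (U k - U (k-1)) = (d (k+1) - knot_value U d k) / (U (k+1) - U k)"
proof -
  define a b where "a = U k - U (k-1)" and "b = U (k+1) - U k"
  have "a > 0" "b > 0" using full_knots_less[OF assms] by (auto simp: a_def b_def)
  moreover have "knot_value U d k = (b * d k + a * d (k+1)) / (a + b)"
    unfolding knot_value_def a_def b_def by simp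
  ultimately show ?thesis unfolding a_def[symmetric] b_def[symmetric]
    by (simp add: divide_simps) (simp add: algebra_simps)
qed

text \<open>Value, tangential derivative and normal derivative on a common edge are expressed in \<open>patch_0\<close> and
  \<open>patch_1\<close> by the value and the slope of the univariate spline at \<open>U\<^sub>k\<close>, and these agree on both sides.\<close>

lemma cell_jet_match:
  assumes U: "full_knots U" and V: "full_knots V" and y: "y \<in> {V (l-1)..V l}"
  shows "cell_jet U V d e k l (U k) y = cell_jet U V d e (k+1) l (U k) y"
proof -
  have lt: "U (k-1) < U k" "U k < U (k+1)" using full_knots_less[OF U] by auto
  have l: "local_coord U k (U k) = 1" "local_coord U (k+1) (U k) = 0" using lt by (auto simp: local_coord_def)
  note P = patch_0[OF local_coord_bounds[OF V y]] patch_1[OF local_coord_bounds[OF V y]]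
  have "2 * (knot_value U d k - d k) * w / (U k - U (k-1)) = 2 * (d (k+1) - knot_value U d k) * w / (U (k+1) - U k)" for w
    using arg_cong[OF knot_value_slope[OF U, of d k], of "\<lambda>s. 2 * s * w"] by simp
  then show ?thesis
    unfolding cell_jet_def cell_spline_def cell_dx_def by (simp add: l P)
qed

lemma cell_jet_indep_x:
  assumes U: "full_knots U" and V: "full_knots V" and y: "y \<in> {V (l-1)..V l}"
    and x: "x \<in> {U (k-1)..U k}" "x \<in> {U (k'-1)..U k'}"
  shows "cell_jet U V d e k l x y = cell_jet U V d e k' l x y"
proof -
  have *: "cell_jet U V d e k l x y = cell_jet U V d e k' l x y"
    if "k < k'" "x \<in> {U (k-1)..U k}" "x \<in> {U (k'-1)..U k'}" for k k'
  proof -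
    have "\<not> k < k' - 1" using full_knots_less[OF U, of k "k' - 1"] that by auto
    then have k': "k' = k + 1" using that(1) by auto
    then have "x = U k" using that by auto
    then show ?thesis using cell_jet_match[OF U V y] k' by simp
  qed
  consider "k < k'" | "k = k'" | "k' < k" by linarith
  then show ?thesis
    by cases (rule *[OF _ x], assumption, simp only:, rule *[OF _ x(2,1), symmetric], assumption)
qed

lemma cell_jet_indep:
  assumes U: "full_knots U" and V: "full_knots V"
    and "x \<in> {U (k-1)..U k}" "x \<in> {U (k'-1)..U k'}" "y \<in> {V (l-1)..V l}" "y \<in> {V (l'-1)..V l'}"
  shows "cell_jet U V d e k l x y = cell_jet U V d e k' l' x y"
proof -
  have "cell_jet U V d e k l x y = cell_jet U V d e k' l x y"
    by (rule cell_jet_indep_x) (use assms in auto)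
  also have "\<dots> = cell_jet U V d e k' l' x y"
    unfolding cell_jet_swap[of U V]
    by (subst cell_jet_indep_x[of V U x k' y l l']) (use assms in auto)
  finally show ?thesis .
qed

lemma spline_on_cell:
  assumes U: "full_knots U" and V: "full_knots V"
    and x: "x \<in> {U (k-1)..U k}" and y: "y \<in> {V (l-1)..V l}"
  shows "spline U V d e (x, y) = cell_spline U V d e k l x y"
    and "spline_grad U V d e (x, y) = (cell_dx U V d e k l x y, cell_dx V U e d l k y x)"
proof -
  have "cell_jet U V d e (cell_index U x) (cell_index V y) x y = cell_jet U V d e k l x y"
    using cell_index_bounds[OF U, of x] cell_index_bounds[OF V, of y] x y by (intro cell_jet_indep U V) auto
  then show "spline U V d e (x, y) = cell_spline U V d e k l x y"
    and "spline_grad U V d e (x, y) = (cell_dx U V d e k l x y, cell_dx V U e d l k y x)"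
    by (auto simp: spline_def spline_grad_def cell_jet_def)
qed

text \<open>The closed cells are locally finite: near every point four of them suffice. A limit
  along each of the cells is therefore a limit in the plane.\<close>

lemma tendsto_glue:
  fixes g :: "real \<times> real \<Rightarrow> 'a :: topological_space"
  assumes U: "full_knots U" and V: "full_knots V"
    and cell: "\<And>k l. z \<in> {U (k-1)..U k} \<times> {V (l-1)..V l} \<Longrightarrow>
      (g \<longlongrightarrow> L) (at z within {U (k-1)..U k} \<times> {V (l-1)..V l})"
  shows "(g \<longlongrightarrow> L) (at z)"
proof -
  let ?C = "\<lambda>k l. {U (k-1)..U k} \<times> {V (l-1)..V l}"
  have C: "(g \<longlongrightarrow> L) (at z within ?C k l)" for k l
  proof (cases "z \<in> ?C k l")
    case False
    have "closed (?C k l)" by (intro closed_Times closed_atLeastAtMost)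
    then have "z \<notin> closure (?C k l - {z})"
      using False by (simp only: Diff_insert0 Diff_empty closure_closed not_False_eq_True)
    then have "at z within ?C k l = bot" unfolding at_within_eq_bot_iff .
    then show ?thesis by (simp only: tendsto_bot)
  qed (rule cell)
  define k where "k = cell_index U (fst z)"
  define l where "l = cell_index V (snd z)"
  \<comment> \<open>A point may lie on the lower or left side of the cell chosen by the index, so the neighbourhood
    reaches one cell further in these directions.\<close>
  let ?S = "{U (k-1-1)<..<U k} \<times> {V (l-1-1)<..<V l}"
  have "open ?S" by (intro open_Times) auto
  moreover have "z \<in> ?S"
    using cell_index_bounds[OF U, of "fst z", folded k_def] cell_index_bounds[OF V, of "snd z", folded l_def]
      full_knots_less[OF U, of "k-1-1" "k-1"] full_knots_less[OF V, of "l-1-1" "l-1"]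
    by (cases z) auto
  ultimately have "at z = at z within ?S" by (intro at_within_open[symmetric])
  moreover have "(g \<longlongrightarrow> L) (at z within ?S)"
  proof (rule tendsto_within_subset)
    show "(g \<longlongrightarrow> L) (at z within (?C (k-1) (l-1) \<union> ?C (k-1) l) \<union> (?C k (l-1) \<union> ?C k l))"
      by (intro Lim_Un C)
  qed auto
  ultimately show ?thesis by (simp only:)
qed

lemma cell_spline_has_derivative:
  "((\<lambda>z. cell_spline U V d e k l (fst z) (snd z)) has_derivative
    (\<lambda>h. h \<bullet> (cell_dx U V d e k l (fst z) (snd z), cell_dx V U e d l k (snd z) (fst z)))) (at z within S)"
proof -
  have "((\<lambda>z. local_coord U k (fst z)) has_derivative (\<lambda>h. fst h / (U k - U (k-1)))) (at z within S)"
    "((\<lambda>z. local_coord V l (snd z)) has_derivative (\<lambda>h. snd h / (V l - V (l-1)))) (at z within S)"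
    unfolding local_coord_def divide_inverse by (auto intro!: derivative_eq_intros)
  from patch_has_derivative[OF this] show ?thesis
    unfolding cell_spline_def cell_dx_def by (simp add: inner_prod_def mult.commute)
qed

lemma spline_C1:
  assumes U: "full_knots U" and V: "full_knots V"
  shows "C1_plane (spline U V d e)"
proof -
  let ?C = "\<lambda>k l. {U (k-1)..U k} \<times> {V (l-1)..V l}"
  let ?F = "spline U V d e" and ?G = "spline_grad U V d e"
  have "GDERIV ?F z :> ?G z" for z
    unfolding gderiv_def has_derivative_within
  proof (intro conjI tendsto_glue[OF U V])
    show "bounded_linear (\<lambda>h. h \<bullet> ?G z)" by (rule bounded_linear_inner_left)
    fix k l assume z: "z \<in> ?C k l"
    have e: "?G z = (cell_dx U V d e k l (fst z) (snd z), cell_dx V U e d l k (snd z) (fst z))"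
      using spline_on_cell(2)[OF U V, of "fst z" k "snd z" l] z by (cases z) auto
    have "(?F has_derivative (\<lambda>h. h \<bullet> ?G z)) (at z within ?C k l)"
      unfolding e
      by (rule has_derivative_transform[OF z _ cell_spline_has_derivative])
        (use spline_on_cell(1)[OF U V] in force)
    then show "((\<lambda>y. (1 / norm (y - z)) *\<^sub>R (?F y - (?F z + (y - z) \<bullet> ?G z))) \<longlongrightarrow> 0) (at z within ?C k l)"
      unfolding has_derivative_within by blast
  qed
  moreover have "(?G \<longlongrightarrow> ?G z) (at z)" for z
  proof (rule tendsto_glue[OF U V])
    fix k l assume z: "z \<in> ?C k l"
    have "continuous_on (?C k l) (\<lambda>z. (cell_dx U V d e k l (fst z) (snd z), cell_dx V U e d l k (snd z) (fst z)))"
      unfolding cell_dx_def local_coord_def divide_inverse by (intro continuous_intros)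
    moreover have "(cell_dx U V d e k l (fst w) (snd w), cell_dx V U e d l k (snd w) (fst w)) = ?G w"
      if "w \<in> ?C k l" for w
      using spline_on_cell(2)[OF U V, of "fst w" k "snd w" l] that by (cases w) auto
    ultimately have "continuous_on (?C k l) ?G" by (rule continuous_on_eq)
    then show "(?G \<longlongrightarrow> ?G z) (at z within ?C k l)" using z unfolding continuous_on_def by blast
  qed
  then have "continuous_on UNIV ?G" by (simp add: continuous_on_def)
  ultimately show ?thesis unfolding C1_plane_def by blast
qed

section \<open>Identification of the classical B-splines\<close>

definition affine_fn :: "(real \<times> real \<Rightarrow> real) \<Rightarrow> bool" where
  "affine_fn L \<longleftrightarrow> (\<exists>a b c. \<forall>z. L z = a + b * fst z + c * snd z)"

lemma affine_fn_lincomb: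
  assumes "affine_fn f" "affine_fn g"
  shows "affine_fn (\<lambda>z. p + q * f z + r * g z)"
proof -
  obtain a b c a' b' c' where "\<forall>z. f z = a + b * fst z + c * snd z" "\<forall>z. g z = a' + b' * fst z + c' * snd z"
    using assms unfolding affine_fn_def by blast
  then have "\<forall>z. p + q * f z + r * g z = (p + q * a + r * a') + (q * b + r * b') * fst z + (q * c + r * c') * snd z"
    by (simp add: algebra_simps)
  then show ?thesis unfolding affine_fn_def by blast
qed

lemma quadratic_square:
  assumes "affine_fn L"
  shows "quadratic_on T (\<lambda>z. (L z)^2)"
proof -
  obtain a b c where "\<forall>z. L z = a + b * fst z + c * snd z" using assms unfolding affine_fn_def by blast
  then have "\<forall>x y. (x, y) \<in> T \<longrightarrow> (L (x, y))^2 =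
      a^2 + (2 * a * b) * x + (2 * a * c) * y + b^2 * x^2 + (2 * b * c) * x * y + c^2 * y^2"
    by (simp add: power2_eq_square algebra_simps)
  then show ?thesis unfolding quadratic_on_def by blast
qed

lemma affine_nonneg_hull:
  assumes "affine_fn L" "\<And>V. V \<in> S \<Longrightarrow> 0 \<le> L V" "z \<in> convex hull S"
  shows "0 \<le> L z"
proof -
  obtain a b c where L: "\<forall>z. L z = a + b * fst z + c * snd z" using assms unfolding affine_fn_def by blast
  have "{z. 0 \<le> L z} = {z. (b, c) \<bullet> z \<ge> - a}" by (auto simp: L inner_prod_def)
  then have "convex {z. 0 \<le> L z}" by (simp only: convex_halfspace_ge)
  then have "convex hull S \<subseteq> {z. 0 \<le> L z}" using assms(2) by (intro hull_minimal) auto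
  then show ?thesis using assms(3) by blast
qed

text \<open>An affine function of constant sign at the vertices has that sign on the hull, where its
  truncated square is then either its square or 0.\<close>

lemma quadratic_pos_sq:
  assumes L: "affine_fn L" and sign: "(\<forall>V\<in>S. 0 \<le> L V) \<or> (\<forall>V\<in>S. L V \<le> 0)"
  shows "quadratic_on (convex hull S) (\<lambda>z. pos_sq (L z))"
  using sign
proof
  assume "\<forall>V\<in>S. 0 \<le> L V"
  then have "\<forall>z\<in>convex hull S. pos_sq (L z) = (L z)^2"
    using affine_nonneg_hull[OF L, of S] by (simp add: pos_sq_def)
  then show ?thesis using quadratic_square[OF L, of "convex hull S"] by (simp add: quadratic_on_def)
next
  assume "\<forall>V\<in>S. L V \<le> 0"
  moreover have "affine_fn (\<lambda>z. - L z)" using affine_fn_lincomb[OF L L, of 0 "-1" 0] by simp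
  ultimately have "\<forall>z\<in>convex hull S. 0 \<le> - L z"
    using affine_nonneg_hull[of "\<lambda>z. - L z" S] by simp
  then have "\<forall>z\<in>convex hull S. pos_sq (L z) = 0" by (auto simp: pos_sq_def)
  then show ?thesis unfolding quadratic_on_def
    by (intro exI[of _ 0]) auto
qed

lemma quadratic_add: "quadratic_on T F \<Longrightarrow> quadratic_on T H \<Longrightarrow> quadratic_on T (\<lambda>z. F z + H z)"
  using quadratic_on_lincomb[of T F H 1 1] by simp

lemma quadratic_diff: "quadratic_on T F \<Longrightarrow> quadratic_on T H \<Longrightarrow> quadratic_on T (\<lambda>z. F z - H z)"
  using quadratic_on_lincomb[of T F H 1 "-1"] by simp

lemma quadratic_cmult: "quadratic_on T F \<Longrightarrow> quadratic_on T (\<lambda>z. c * F z)"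
  using quadratic_on_lincomb[of T F F c 0] by simp

lemma patch_quadratic:
  assumes f: "affine_fn f" and g: "affine_fn g"
    and s1: "(\<forall>V\<in>S. f V + g V \<le> 1) \<or> (\<forall>V\<in>S. 1 \<le> f V + g V)"
    and s2: "(\<forall>V\<in>S. f V \<le> g V) \<or> (\<forall>V\<in>S. g V \<le> f V)"
  shows "quadratic_on (convex hull S) (\<lambda>z. patch p0 p1 p2 q0 q1 q2 (f z) (g z))"
proof -
  let ?T = "convex hull S"
  have a: "affine_fn (\<lambda>z. 1 - f z - g z)" "affine_fn (\<lambda>z. f z + g z - 1)" "affine_fn (\<lambda>z. g z - f z)"
    "affine_fn (\<lambda>z. f z - g z)" "affine_fn (\<lambda>z. 1 - f z)" "affine_fn (\<lambda>z. 1 - g z)"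
    using affine_fn_lincomb[OF f g, of 1 "-1" "-1"] affine_fn_lincomb[OF f g, of "-1" 1 1]
      affine_fn_lincomb[OF f g, of 0 "-1" 1] affine_fn_lincomb[OF f g, of 0 1 "-1"]
      affine_fn_lincomb[OF f g, of 1 "-1" 0] affine_fn_lincomb[OF f g, of 1 0 "-1"]
    by (simp_all add: algebra_simps)
  have "quadratic_on ?T (\<lambda>z. pos_sq (1 - f z - g z))" "quadratic_on ?T (\<lambda>z. pos_sq (f z + g z - 1))"
    by (rule quadratic_pos_sq[OF a(1)] quadratic_pos_sq[OF a(2)]; use s1 in force)+
  moreover have "quadratic_on ?T (\<lambda>z. pos_sq (g z - f z))" "quadratic_on ?T (\<lambda>z. pos_sq (f z - g z))"
    by (rule quadratic_pos_sq[OF a(3)] quadratic_pos_sq[OF a(4)]; use s2 in force)+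
  ultimately show ?thesis
    unfolding patch_def Let_def
    by (intro quadratic_add quadratic_diff quadratic_cmult quadratic_square f g a)
qed

lemma cell_spline_quadratic:
  assumes U: "full_knots U" and V: "full_knots V"
    and T: "T \<in> cell_triangles (U (k-1)) (U k) (V (l-1)) (V l)"
  shows "quadratic_on T (\<lambda>z. cell_spline U V d e k l (fst z) (snd z))"
proof -
  have lt: "U (k-1) < U k" "V (l-1) < V l" using full_knots_less U V by auto
  have L: "local_coord U k (U (k-1)) = 0" "local_coord U k (U k) = 1" "local_coord U k ((U (k-1) + U k) / 2) = 1/2"
    "local_coord V l (V (l-1)) = 0" "local_coord V l (V l) = 1" "local_coord V l ((V (l-1) + V l) / 2) = 1/2"
    using lt by (auto simp: local_coord_def field_simps)
  have "affine_fn fst" unfolding affine_fn_def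
    by (rule exI[of _ 0], rule exI[of _ 1], rule exI[of _ 0]) simp
  then have f: "affine_fn (\<lambda>z. local_coord U k (fst z))"
    using affine_fn_lincomb[of fst fst "- U (k-1) / (U k - U (k-1))" "1 / (U k - U (k-1))" 0]
    by (simp add: local_coord_def diff_divide_distrib)
  have "affine_fn snd" unfolding affine_fn_def
    by (rule exI[of _ 0], rule exI[of _ 0], rule exI[of _ 1]) simp
  then have g: "affine_fn (\<lambda>z. local_coord V l (snd z))"
    using affine_fn_lincomb[of snd snd "- V (l-1) / (V l - V (l-1))" "1 / (V l - V (l-1))" 0]
    by (simp add: local_coord_def diff_divide_distrib)
  show ?thesis
    using T unfolding cell_triangles_def Let_def cell_spline_def insert_iff empty_iff
    by (elim disjE FalseE; hypsubst; intro patch_quadratic f g; simp add: L)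
qed

lemma quadratic_on_cong:
  "(\<And>z. z \<in> T \<Longrightarrow> F z = H z) \<Longrightarrow> quadratic_on T F \<longleftrightarrow> quadratic_on T H"
  unfolding quadratic_on_def by auto

lemma cell_triangles_subset:
  assumes "x0 \<le> x1" "y0 \<le> y1" "T \<in> cell_triangles x0 x1 y0 y1"
  shows "T \<subseteq> {x0..x1} \<times> {y0..y1}"
proof -
  have c: "convex ({x0..x1} \<times> {y0..y1})" by (intro convex_Times) auto
  show ?thesis
    using assms(3) unfolding cell_triangles_def Let_def insert_iff empty_iff
    by (elim disjE FalseE; hypsubst; intro hull_minimal c) (use assms(1,2) in auto)
qed

lemma spline_quadratic:
  assumes U: "full_knots U" and V: "full_knots V"
    and T: "T \<in> cell_triangles (U (k-1)) (U k) (V (l-1)) (V l)"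
  shows "quadratic_on T (spline U V d e)"
proof -
  have "T \<subseteq> {U (k-1)..U k} \<times> {V (l-1)..V l}"
    using full_knots_less[OF U, of "k-1" k] full_knots_less[OF V, of "l-1" l]
    by (intro cell_triangles_subset[OF _ _ T]) auto
  then have "spline U V d e z = cell_spline U V d e k l (fst z) (snd z)" if "z \<in> T" for z
    using that spline_on_cell(1)[OF U V, of "fst z" k "snd z" l] by (cases z) auto
  then show ?thesis
    using cell_spline_quadratic[OF U V T] by (subst quadratic_on_cong)
qed

definition unit_seq :: "int \<Rightarrow> int \<Rightarrow> real" where
  "unit_seq p k = (if k = p then 1 else 0)"

lemma box_subset_convex:
  fixes C :: "(real \<times> real) set"
  assumes C: "convex C" and P: "(x0, y0) \<in> C" "(x1, y0) \<in> C" "(x0, y1) \<in> C" "(x1, y1) \<in> C"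
    and lt: "x0 < x1" "y0 < y1"
    and z: "x \<in> {x0..x1}" "y \<in> {y0..y1}"
  shows "(x, y) \<in> C"
proof -
  obtain T where T: "T \<in> cell_triangles x0 x1 y0 y1" "(x, y) \<in> T" using cell_cover[OF lt z] by blast
  have "(1/2) *\<^sub>R (x0, y0) + (1/2) *\<^sub>R (x1, y1) \<in> C"
    using convexD[OF C P(1) P(4), of "1/2" "1/2"] by simp
  then have "((x0 + x1) / 2, (y0 + y1) / 2) \<in> C" by (simp add: add_divide_distrib)
  then have "T \<subseteq> C"
    using T(1) P unfolding cell_triangles_def Let_def insert_iff empty_iff
    by (elim disjE FalseE; hypsubst; intro hull_minimal C; auto)
  then show ?thesis using T(2) by blast
qed

lemma in_triangle_convex:
  fixes A B D :: "real \<times> real"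
  assumes "convex C" "A \<in> C" "B \<in> C" "D \<in> C" "0 \<le> p" "0 \<le> q" "0 \<le> r" "p + q + r = 1"
    "x = p * fst A + q * fst B + r * fst D" "y = p * snd A + q * snd B + r * snd D"
  shows "(x, y) \<in> C"
proof -
  have "convex hull {A, B, D} \<subseteq> C" using assms by (intro hull_minimal) auto
  then show ?thesis using in_triangle[OF assms(5-10)] by blast
qed

lemma knot_value_unit_seq:
  "knot_value U (unit_seq p) k = (if k = p then (U (p+1) - U p) / (U (p+1) - U (p-1))
    else if k = p - 1 then (U (p-1) - U (p-2)) / (U p - U (p-2)) else 0)"
  by (auto simp: knot_value_def unit_seq_def)

lemma local_coord_eq:
  assumes "full_knots U"
  shows "x = U (k-1) + local_coord U k x * (U k - U (k-1))"
  using full_knots_less[OF assms, of "k-1" k] by (simp add: local_coord_def)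

text \<open>The Bernstein coefficients of a univariate B-spline are nonzero only on three intervals. This
  leaves a block of nine cells; the five that touch the middle row or column lie in the octagon, and in each
  corner cell a single truncated square remains, which is zero beyond the diagonal that bounds the octagon.\<close>

lemma spline_octagon:
  assumes U: "full_knots U" and V: "full_knots V"
    and z: "(x, y) \<notin> octagon U V p q"
  shows "spline U V (unit_seq p) (unit_seq q) (x, y) = 0"
proof -
  define k l where "k = cell_index U x" and "l = cell_index V y"
  have x: "x \<in> {U (k-1)..U k}" and y: "y \<in> {V (l-1)..V l}"
    using cell_index_bounds[OF U, of x] cell_index_bounds[OF V, of y] by (auto simp: k_def l_def)
  define X Y where "X = local_coord U k x" and "Y = local_coord V l y"
  have XY: "0 \<le> X" "X \<le> 1" "0 \<le> Y" "Y \<le> 1"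
    using local_coord_bounds[OF U x] local_coord_bounds[OF V y] by (auto simp: X_def Y_def)
  have xe: "x = U (k-1) + X * (U k - U (k-1))" and ye: "y = V (l-1) + Y * (V l - V (l-1))"
    unfolding X_def Y_def by (rule local_coord_eq[OF U] local_coord_eq[OF V])+
  have mono: "U i \<le> U j" "V i \<le> V j" if "i \<le> j" for i j
    using full_knots_less[OF U, of i j] full_knots_less[OF V, of i j] that by (cases "i = j"; auto)+
  let ?O = "octagon U V p q"
  have conv: "convex ?O" unfolding octagon_def by (rule convex_convex_hull)
  have vert: "(U (p-2), V (q-1)) \<in> ?O" "(U (p-2), V q) \<in> ?O" "(U (p-1), V (q+1)) \<in> ?O" "(U p, V (q+1)) \<in> ?O"
    "(U (p+1), V q) \<in> ?O" "(U (p+1), V (q-1)) \<in> ?O" "(U p, V (q-2)) \<in> ?O" "(U (p-1), V (q-2)) \<in> ?O"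
    unfolding octagon_def by (rule hull_inc, simp)+
  have strip_h: "(a, b) \<in> ?O" if "a \<in> {U (p-2)..U (p+1)}" "b \<in> {V (q-1)..V q}" for a b
    by (rule box_subset_convex[OF conv vert(1) vert(6) vert(2) vert(5) _ _ that])
      (auto intro: full_knots_less U V)
  have strip_v: "(a, b) \<in> ?O" if "a \<in> {U (p-1)..U p}" "b \<in> {V (q-2)..V (q+1)}" for a b
    by (rule box_subset_convex[OF conv vert(8) vert(7) vert(3) vert(4) _ _ that])
      (auto intro: full_knots_less U V)
  have inner: "(U (p-1), V (q-1)) \<in> ?O" "(U (p-1), V q) \<in> ?O" "(U p, V (q-1)) \<in> ?O" "(U p, V q) \<in> ?O"
    by (rule strip_h; auto intro: mono)+
  have s: "spline U V (unit_seq p) (unit_seq q) (x, y) =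
    patch (knot_value U (unit_seq p) (k-1)) (unit_seq p k) (knot_value U (unit_seq p) k)
      (knot_value V (unit_seq q) (l-1)) (unit_seq q l) (knot_value V (unit_seq q) l) X Y"
    unfolding spline_on_cell(1)[OF U V x y] cell_spline_def X_def Y_def by simp
  consider "k \<notin> {p-1, p, p+1} \<or> l \<notin> {q-1, q, q+1}" | "k = p" "l \<in> {q-1, q, q+1}"
    | "l = q" "k \<in> {p-1, p, p+1}" | "k = p+1" "l = q+1" | "k = p-1" "l = q+1"
    | "k = p+1" "l = q-1" | "k = p-1" "l = q-1" by blast
  then show ?thesis
  proof cases
    case 1
    then show ?thesis unfolding s
      by (auto simp: knot_value_unit_seq unit_seq_def patch_def Let_def)
  next
    case 2
    then have "V (q-2) \<le> V (l-1)" "V l \<le> V (q+1)" by (auto intro: mono)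
    then show ?thesis using strip_v[of x y] x y 2 z by auto
  next
    case 3
    then have "U (p-2) \<le> U (k-1)" "U k \<le> U (p+1)" by (auto intro: mono)
    then show ?thesis using strip_h[of x y] x y 3 z by auto
  next
    case 4
    have "1 \<le> X + Y"
    proof (rule ccontr)
      assume "\<not> 1 \<le> X + Y"
      then have "(x, y) \<in> ?O"
        by (intro in_triangle_convex[OF conv inner(4) vert(5) vert(4), where p = "1 - X - Y" and q = X and r = Y])
          (use XY xe ye 4 in \<open>auto simp: algebra_simps\<close>)
      then show False using z by simp
    qed
    then show ?thesis unfolding s
      by (auto simp: 4 knot_value_unit_seq unit_seq_def patch_def Let_def pos_sq_def)
  next
    case 5
    have "X \<le> Y"
    proof (rule ccontr)
      assume "\<not> X \<le> Y"
      then have "(x, y) \<in> ?O"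
        by (intro in_triangle_convex[OF conv vert(2) inner(2) vert(3), where p = "1 - X" and q = "X - Y" and r = Y])
          (use XY xe ye 5 in \<open>auto simp: algebra_simps\<close>)
      then show False using z by simp
    qed
    then show ?thesis unfolding s
      by (auto simp: 5 knot_value_unit_seq unit_seq_def patch_def Let_def pos_sq_def)
  next
    case 6
    have "Y \<le> X"
    proof (rule ccontr)
      assume "\<not> Y \<le> X"
      then have "(x, y) \<in> ?O"
        by (intro in_triangle_convex[OF conv vert(7) inner(3) vert(6), where p = "1 - Y" and q = "Y - X" and r = X])
          (use XY xe ye 6 in \<open>auto simp: algebra_simps\<close>)
      then show False using z by simp
    qed
    then show ?thesis unfolding s
      by (auto simp: 6 knot_value_unit_seq unit_seq_def patch_def Let_def pos_sq_def)
  next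
    case 7
    have "X + Y \<le> 1"
    proof (rule ccontr)
      assume "\<not> X + Y \<le> 1"
      then have "(x, y) \<in> ?O"
        by (intro in_triangle_convex[OF conv vert(1) vert(8) inner(1), where p = "1 - X" and q = "1 - Y" and r = "X + Y - 1"])
          (use XY xe ye 7 in \<open>auto simp: algebra_simps\<close>)
      then show False using z by simp
    qed
    then show ?thesis unfolding s
      by (auto simp: 7 knot_value_unit_seq unit_seq_def patch_def Let_def pos_sq_def)
  qed
qed

lemma spline_knot:
  assumes U: "full_knots U" and V: "full_knots V"
  shows "spline U V d e (U k, V l) = knot_value U d k * knot_value V e l"
proof -
  have lt: "U (k-1) < U k" "V (l-1) < V l" using full_knots_less U V by auto
  then have "local_coord U k (U k) = 1" "local_coord V l (V l) = 1" by (auto simp: local_coord_def)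
  then show ?thesis
    using spline_on_cell(1)[OF U V, of "U k" k "V l" l] lt by (simp add: cell_spline_def patch_1)
qed

lemma classical_bspline_eq_spline:
  assumes U: "full_knots U" "\<forall>k\<in>{-2..m+2}. U k = u k"
    and V: "full_knots V" "\<forall>l\<in>{-2..n+2}. V l = v l"
    and ij: "i \<in> {0..m+1}" "j \<in> {0..n+1}"
  shows "classical_bspline m n u v i j = spline U V (unit_seq i) (unit_seq j)"
proof -
  let ?F = "spline U V (unit_seq i) (unit_seq j)"
  have u: "u (i-2) = U (i-2)" "u (i-1) = U (i-1)" "u i = U i" "u (i+1) = U (i+1)"
    using ij by (simp_all add: U(2))
  have v: "v (j-2) = V (j-2)" "v (j-1) = V (j-1)" "v j = V j" "v (j+1) = V (j+1)"
    using ij by (simp_all add: V(2))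
  have su: "strict_mono_on {-2..m+2} u" and sv: "strict_mono_on {-2..n+2} v"
    using full_knots_less[OF U(1)] full_knots_less[OF V(1)]
    by (auto simp: monotone_on_def simp flip: U(2)[THEN bspec] V(2)[THEN bspec])
  have "is_classical_bspline m n u v i j ?F"
    unfolding is_classical_bspline_def
  proof (intro conjI ballI allI impI)
    show "C1_plane ?F" by (rule spline_C1[OF U(1) V(1)])
  next
    fix T assume "T \<in> crisscross m n u v"
    then obtain k l where "k \<in> {-1..m+2}" "l \<in> {-1..n+2}"
      "T \<in> cell_triangles (u (k-1)) (u k) (v (l-1)) (v l)"
      unfolding crisscross_def by blast
    then have "T \<in> cell_triangles (U (k-1)) (U k) (V (l-1)) (V l)" by (simp add: U(2) V(2))
    then show "quadratic_on T ?F" by (rule spline_quadratic[OF U(1) V(1)])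
  next
    fix z assume "z \<notin> octagon u v i j"
    moreover have "octagon u v i j = octagon U V i j" unfolding octagon_def u v ..
    ultimately show "?F z = 0" using spline_octagon[OF U(1) V(1)] by (cases z) simp
  next
    show "?F (u i, v j) = (u (i + 1) - u i) / (u (i + 1) - u (i - 1))
                 * ((v (j + 1) - v j) / (v (j + 1) - v (j - 1)))"
      unfolding u v spline_knot[OF U(1) V(1)] by (simp add: knot_value_unit_seq)
  qed
  then show ?thesis
    unfolding classical_bspline_def
    by (intro the_equality[where P = "is_classical_bspline m n u v i j"] classical_bspline_unique[OF su sv ij])
qed

section \<open>B-splines on the rectangle: nonnegativity and partition of unity\<close>

lemma cell_spline_sum:
  "cell_spline U V (\<lambda>k. \<Sum>p\<in>I. a p * D p k) e k l x y = (\<Sum>p\<in>I. a p * cell_spline U V (D p) e k l x y)"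
proof -
  have kv: "knot_value U (\<lambda>k. \<Sum>p\<in>I. a p * D p k) k = (\<Sum>p\<in>I. a p * knot_value U (D p) k)" for k
    unfolding knot_value_def sum_distrib_left sum.distrib[symmetric] sum_divide_distrib
    by (rule sum.cong) (simp_all add: field_simps)
  show ?thesis
    unfolding cell_spline_def kv
    by (subst (1 2) patch_linear)
      (simp add: sum_distrib_left sum_distrib_right sum.distrib distrib_left mult.assoc)
qed

lemma spline_sum_left:
  "spline U V (\<lambda>k. \<Sum>p\<in>I. a p * D p k) e z = (\<Sum>p\<in>I. a p * spline U V (D p) e z)"
  unfolding spline_def by (rule cell_spline_sum)

lemma spline_sum_right:
  "spline U V d (\<lambda>k. \<Sum>p\<in>I. a p * D p k) z = (\<Sum>p\<in>I. a p * spline U V d (D p) z)"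
  unfolding spline_def cell_spline_swap[of U V] by (rule cell_spline_sum)

text \<open>The coefficients \<open>\<alpha>\<^sub>i\<^sub>p\<close> with \<open>p\<close> outside the range of the sum replaced by 0.\<close>

definition control_coef :: "int \<Rightarrow> (int \<Rightarrow> real) \<Rightarrow> (int \<Rightarrow> real) \<Rightarrow> int \<Rightarrow> int \<Rightarrow> real" where
  "control_coef m x u i k = (\<Sum>p\<in>{0..m+1}. alpha m x u i p * unit_seq p k)"

lemma control_coef_eq: "k \<in> {0..m+1} \<Longrightarrow> control_coef m x u i k = alpha m x u i k"
  unfolding control_coef_def unit_seq_def by (simp add: if_distrib cong: if_cong)

lemma bspline_eq_spline:
  assumes U: "full_knots U" "\<forall>k\<in>{-2..m+2}. U k = u k"
    and V: "full_knots V" "\<forall>l\<in>{-2..n+2}. V l = v l"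
  shows "bspline m n x y u v i j z = spline U V (control_coef m x u i) (control_coef n y v j) z"
proof -
  have "spline U V (control_coef m x u i) (control_coef n y v j) z =
      (\<Sum>p\<in>{0..m+1}. alpha m x u i p * (\<Sum>q\<in>{0..n+1}. alpha n y v j q * spline U V (unit_seq p) (unit_seq q) z))"
    unfolding control_coef_def spline_sum_left spline_sum_right ..
  also have "\<dots> = bspline m n x y u v i j z"
    unfolding bspline_def sum_distrib_left
    by (intro sum.cong refl) (simp add: classical_bspline_eq_spline[OF U V])
  finally show ?thesis ..
qed

text \<open>The comparison of the coefficients \<open>\<alpha>\<close> with the knots is the same for both variables.\<close>

locale boundary_knots =
  fixes m :: int and a b :: real and x u U :: "int \<Rightarrow> real"
  assumes partition: "is_partition m a b x" and extended: "extended_knots m x u"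
    and full: "full_knots U" and agree: "\<forall>k\<in>{-2..m+2}. U k = u k"
begin

lemma m: "1 \<le> m" using partition by (simp add: is_partition_def)

lemma U_x: "k \<in> {0..m} \<Longrightarrow> U k = x k"
  using bspec[OF agree, of k] extended by (auto simp: extended_knots_def)

lemma U_less: "i < j \<Longrightarrow> U i < U j" by (rule full_knots_less[OF full])

lemma alpha_U:
  "alpha m x u i p =
    (if i = 0 \<and> p = 0 then (U 1 - U (-1)) / (U 1 - U 0)
     else if i = m + 1 \<and> p = m + 1 then (U (m+1) - U (m-1)) / (U m - U (m-1))
     else if 1 \<le> i \<and> i \<le> m \<and> p = i then 1
     else if i = 1 \<and> p = 0 then - (U 0 - U (-1)) / (U 1 - U 0)
     else if i = m \<and> p = m + 1 then - (U (m+1) - U m) / (U m - U (m-1))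
     else 0)"
proof -
  have "step m x 1 = U 1 - U 0" "step m x m = U m - U (m-1)"
    using m by (simp_all add: step_def knot_def U_x)
  moreover have "u 0 = U 0" "u (-1) = U (-1)" "u m = U m" "u (m+1) = U (m+1)"
    using m by (simp_all add: agree)
  ultimately show ?thesis unfolding alpha_def Let_def by simp
qed

lemma control_coef_nonneg: "k \<in> {1..m} \<Longrightarrow> 0 \<le> control_coef m x u i k"
  by (simp add: control_coef_eq alpha_U)

text \<open>At the two ends the negative entries of \<open>\<alpha>\<close> cancel exactly: the value at the end knot is 1 for the
  outermost control sequence and 0 for all others, as for a triple knot.\<close>

lemma knot_valueue_control_coef_nonneg:
  assumes "k \<in> {0..m}"
  shows "0 \<le> knot_value U (control_coef m x u i) k"
proof -
  have c: "control_coef m x u i k = alpha m x u i k" "control_coef m x u i (k+1) = alpha m x u i (k+1)"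
    using assms by (simp_all add: control_coef_eq)
  have p: "0 < U (k+1) - U k" "0 < U k - U (k-1)" "0 < U (k+1) - U (k-1)"
    using U_less by simp_all
  have "0 \<le> (U (k+1) - U k) * alpha m x u i k + (U k - U (k-1)) * alpha m x u i (k+1)"
  proof -
    consider "k = 0" | "k = m" | "1 \<le> k" "k < m" using assms by fastforce
    then show ?thesis
    proof cases
      case 1
      have "0 < U 1 - U 0" "0 < U 1 - U (-1)" using U_less by simp_all
      then show ?thesis using m by (simp add: 1 alpha_U)
    next
      case 2
      have "0 < U m - U (m-1)" "0 < U (m+1) - U (m-1)" using U_less by simp_all
      then show ?thesis using m by (simp add: 2 alpha_U)
    next
      case 3
      then have "0 \<le> alpha m x u i k" "0 \<le> alpha m x u i (k+1)" by (simp_all add: alpha_U)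
      then show ?thesis using p by simp
    qed
  qed
  then show ?thesis unfolding knot_value_def c using p by simp
qed

lemma control_coef_sum:
  assumes "k \<in> {0..m+1}"
  shows "(\<Sum>i\<in>{0..m+1}. control_coef m x u i k) = 1"
proof -
  have "(\<Sum>i\<in>{0..m+1}. control_coef m x u i k) = (\<Sum>i\<in>{0..m+1}. alpha m x u i k)"
    using assms by (simp add: control_coef_eq)
  also have "\<dots> = 1"
  proof -
    consider "k = 0" | "k = m + 1" | "1 \<le> k" "k \<le> m" using assms by fastforce
    then show ?thesis
    proof cases
      case 1
      have "alpha m x u i k = (if i = 0 then (U 1 - U (-1)) / (U 1 - U 0) else 0)
          + (if i = 1 then - (U 0 - U (-1)) / (U 1 - U 0) else 0)" if "i \<in> {0..m+1}" for i
        using m that by (auto simp: 1 alpha_U)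
      then have "(\<Sum>i\<in>{0..m+1}. alpha m x u i k) =
          (U 1 - U (-1)) / (U 1 - U 0) + - (U 0 - U (-1)) / (U 1 - U 0)"
        using m by (simp add: sum.distrib)
      also have "\<dots> = ((U 1 - U (-1)) - (U 0 - U (-1))) / (U 1 - U 0)"
        unfolding diff_divide_distrib[of "U 1 - U (-1)"] minus_divide_left[symmetric] by (rule add_uminus_conv_diff)
      also have "\<dots> = 1" using U_less[of 0 1] by simp
      finally show ?thesis .
    next
      case 2
      have "alpha m x u i k = (if i = m + 1 then (U (m+1) - U (m-1)) / (U m - U (m-1)) else 0)
          + (if i = m then - (U (m+1) - U m) / (U m - U (m-1)) else 0)" if "i \<in> {0..m+1}" for i
        using m that by (auto simp: 2 alpha_U)
      then have "(\<Sum>i\<in>{0..m+1}. alpha m x u i k) =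
          (U (m+1) - U (m-1)) / (U m - U (m-1)) + - (U (m+1) - U m) / (U m - U (m-1))"
        using m by (simp add: sum.distrib)
      also have "\<dots> = ((U (m+1) - U (m-1)) - (U (m+1) - U m)) / (U m - U (m-1))"
        unfolding diff_divide_distrib[of "U (m+1) - U (m-1)"] minus_divide_left[symmetric] by (rule add_uminus_conv_diff)
      also have "\<dots> = 1" using U_less[of "m-1" m] by simp
      finally show ?thesis .
    next
      case 3
      have "alpha m x u i k = (if i = k then 1 else 0)" if "i \<in> {0..m+1}" for i
        using 3 that by (auto simp: alpha_U)
      then show ?thesis using 3 by simp
    qed
  qed
  finally show ?thesis .
qed

lemma cell_exists:
  assumes "t \<in> {a..b}"
  obtains k where "k \<in> {1..m}" "t \<in> {U (k-1)..U k}"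
proof -
  have ab: "U 0 = a" "U m = b" using m partition by (simp_all add: U_x is_partition_def)
  show ?thesis
  proof (cases "t = b")
    case True
    then show ?thesis using that[of m] m ab U_less[of "m-1" m] by auto
  next
    case False
    let ?k = "cell_index U t"
    have k: "U (?k - 1) \<le> t" "t < U ?k" by (rule cell_index_bounds[OF full])+
    have "\<not> ?k \<le> 0" using k ab assms U_less[of ?k 0] by (cases "?k = 0") auto
    moreover have "\<not> ?k - 1 \<ge> m" using k ab assms False U_less[of m "?k - 1"] by (cases "?k - 1 = m") auto
    ultimately show ?thesis using k by (intro that[of ?k]) auto
  qed
qed

end

lemma knot_value_const:
  assumes "full_knots U" "d k = 1" "d (k+1) = 1"
  shows "knot_value U d k = 1"
  using full_knots_less[OF assms(1), of "k-1" "k+1"] assms(2,3) by (simp add: knot_value_def)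

text \<open>A point of the right or upper side of \<open>\<Omega>\<close> is treated in the last cell inside \<open>\<Omega>\<close>; this is
  legitimate because the spline agrees with the patch of every closed cell containing the point.\<close>

lemma bspline_nonneg_sum:
  assumes px: "is_partition m a b x" and py: "is_partition n c d y"
    and ex: "extended_knots m x u" and ey: "extended_knots n y v"
    and z: "z \<in> {a..b} \<times> {c..d}"
  shows "0 \<le> bspline m n x y u v i j z"
    and "(\<Sum>i\<in>{0..m+1}. \<Sum>j\<in>{0..n+1}. bspline m n x y u v i j z) = 1"
proof -
  obtain U where U: "full_knots U" "\<forall>k\<in>{-2..m+2}. U k = u k"
    using extend_knots ex px unfolding extended_knots_def is_partition_def by blast
  obtain V where V: "full_knots V" "\<forall>k\<in>{-2..n+2}. V k = v k"
    using extend_knots ey py unfolding extended_knots_def is_partition_def by blast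
  interpret X: boundary_knots m a b x u U by unfold_locales (use px ex U in auto)
  interpret Y: boundary_knots n c d y v V by unfold_locales (use py ey V in auto)
  obtain s t where st: "z = (s, t)" "s \<in> {a..b}" "t \<in> {c..d}" using z by blast
  obtain k where k: "k \<in> {1..m}" "s \<in> {U (k-1)..U k}" using X.cell_exists[OF st(2)] .
  obtain l where l: "l \<in> {1..n}" "t \<in> {V (l-1)..V l}" using Y.cell_exists[OF st(3)] .
  note B = bspline_eq_spline[OF U V]
  show "0 \<le> bspline m n x y u v i j z"
    unfolding B st(1) spline_on_cell(1)[OF U(1) V(1) k(2) l(2)] cell_spline_def
    using k(1) l(1) local_coord_bounds[OF U(1) k(2)] local_coord_bounds[OF V(1) l(2)]
    by (intro patch_nonneg X.control_coef_nonneg X.knot_valueue_control_coef_nonneg Y.control_coef_nonneg Y.knot_valueue_control_coef_nonneg) auto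
  let ?D = "\<lambda>k. \<Sum>i\<in>{0..m+1}. 1 * control_coef m x u i k" and ?E = "\<lambda>l. \<Sum>j\<in>{0..n+1}. 1 * control_coef n y v j l"
  have D: "?D k' = 1" if "k' \<in> {0..m+1}" for k' using X.control_coef_sum[OF that] by simp
  have E: "?E l' = 1" if "l' \<in> {0..n+1}" for l' using Y.control_coef_sum[OF that] by simp
  have "(\<Sum>i\<in>{0..m+1}. \<Sum>j\<in>{0..n+1}. bspline m n x y u v i j z) = spline U V ?D ?E z"
    unfolding B spline_sum_left spline_sum_right by simp
  also have "\<dots> = cell_spline U V ?D ?E k l s t"
    unfolding st(1) by (rule spline_on_cell(1)[OF U(1) V(1) k(2) l(2)])
  also have "\<dots> = patch 1 1 1 1 1 1 (local_coord U k s) (local_coord V l t)"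
  proof -
    have "knot_value U ?D (k-1) = 1" "?D k = 1" "knot_value U ?D k = 1"
      "knot_value V ?E (l-1) = 1" "?E l = 1" "knot_value V ?E l = 1"
      using k(1) l(1) by (intro knot_value_const U(1) V(1) D E; simp)+
    then show ?thesis unfolding cell_spline_def by simp
  qed
  also have "\<dots> = 1" by (rule patch_one)
  finally show "(\<Sum>i\<in>{0..m+1}. \<Sum>j\<in>{0..n+1}. bspline m n x y u v i j z) = 1" .
qed

section \<open>Norms of the coefficient functionals\<close>

lemma quasi_interpolant_bound:
  assumes "\<And>i j. i \<in> I \<Longrightarrow> j \<in> J \<Longrightarrow> 0 \<le> B i j" "(\<Sum>i\<in>I. \<Sum>j\<in>J. B i j) = (1::real)"
    and "\<And>i j. i \<in> I \<Longrightarrow> j \<in> J \<Longrightarrow> \<bar>\<mu> i j\<bar> \<le> C"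
  shows "\<bar>\<Sum>i\<in>I. \<Sum>j\<in>J. \<mu> i j * B i j\<bar> \<le> C"
proof -
  have "\<bar>\<Sum>i\<in>I. \<Sum>j\<in>J. \<mu> i j * B i j\<bar> \<le> (\<Sum>i\<in>I. \<bar>\<Sum>j\<in>J. \<mu> i j * B i j\<bar>)" by (rule sum_abs)
  also have "\<dots> \<le> (\<Sum>i\<in>I. \<Sum>j\<in>J. \<bar>\<mu> i j * B i j\<bar>)" by (intro sum_mono sum_abs)
  also have "\<dots> \<le> (\<Sum>i\<in>I. \<Sum>j\<in>J. C * B i j)"
    using assms by (intro sum_mono) (auto simp: abs_mult intro!: mult_right_mono)
  also have "\<dots> = C * (\<Sum>i\<in>I. \<Sum>j\<in>J. B i j)" by (simp add: sum_distrib_left)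
  finally show ?thesis by (simp add: assms(2))
qed

lemma knot_mono:
  assumes "is_partition m a b x" "i \<le> j"
  shows "knot m x i \<le> knot m x j"
  unfolding knot_def
  using assms by (intro strict_mono_on_leD[of "{0..m}" x]) (auto simp: is_partition_def)

lemma knot_bounds:
  assumes "is_partition m a b x"
  shows "knot m x i \<in> {a..b}"
proof -
  have "x 0 \<le> x (max 0 (min m i))" "x (max 0 (min m i)) \<le> x m"
    using assms by (auto intro!: strict_mono_on_leD[of "{0..m}" x] simp: is_partition_def)
  then show ?thesis using assms by (simp add: knot_def is_partition_def)
qed

lemma midknot_bounds: "is_partition m a b x \<Longrightarrow> midknot m x i \<in> {a..b}"
  using knot_bounds[of m a b x i] knot_bounds[of m a b x "i-1"] by (auto simp: midknot_def)

lemma sigma_bounds: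
  assumes "is_partition m a b x"
  shows "0 \<le> sigma m x i" "sigma m x i \<le> 1"
proof -
  have "0 \<le> step m x i" for i using knot_mono[OF assms, of "i-1" i] by (simp add: step_def)
  from this[of i] this[of "i-1"] show "0 \<le> sigma m x i" "sigma m x i \<le> 1"
    by (auto simp: sigma_def divide_simps)
qed

text \<open>For \<open>s = \<sigma>\<^sub>i\<close>, \<open>t = \<sigma>'\<^sub>i\<^sub>+\<^sub>1\<close> in \<open>[0,1]\<close> one has \<open>-(a\<^sub>i + c\<^sub>i) = (s\<^sup>2 t + s t\<^sup>2)/(s + t) = s t\<close>. If
  \<open>s + t = 0\<close> the quotients are 0.\<close>

lemma coef_bounds:
  assumes "is_partition m a b x"
  shows "coef_a m x i \<le> 0" "coef_c m x i \<le> 0" "- 1 \<le> coef_a m x i + coef_c m x i"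
proof -
  define s t where "s = sigma m x i" and "t = sigma' m x (i+1)"
  have st: "0 \<le> s" "s \<le> 1" "0 \<le> t" "t \<le> 1"
    using sigma_bounds[OF assms, of i] sigma_bounds[OF assms, of "i+1"] by (auto simp: s_def t_def sigma'_def)
  show "coef_a m x i \<le> 0" "coef_c m x i \<le> 0"
    using st unfolding coef_a_def coef_c_def s_def[symmetric] t_def[symmetric] by (auto simp: divide_simps)
  have "s^2 * t / (s + t) + s * t^2 / (s + t) \<le> 1"
  proof (cases "s + t = 0")
    case False
    have "s^2 * t / (s + t) + s * t^2 / (s + t) = s * t"
    proof -
      have "s^2 * t + s * t^2 = s * t * (s + t)" by (simp add: power2_eq_square algebra_simps)
      then show ?thesis using False by (simp flip: add_divide_distrib)
    qed
    also have "\<dots> \<le> 1" using st by (simp add: mult_le_one)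
    finally show ?thesis .
  qed simp
  then show "- 1 \<le> coef_a m x i + coef_c m x i"
    unfolding coef_a_def coef_c_def s_def[symmetric] t_def[symmetric] by auto
qed

text \<open>Since the outer weights are at most 0 and all weights sum to 1, the central weight is at least 1
  and the absolute values of the weights sum to \<open>1 - 2(a + c + a' + c')\<close>.\<close>

lemma mu_bound:
  assumes px: "is_partition m a b x" and py: "is_partition n c d y"
    and f: "\<And>z. z \<in> {a..b} \<times> {c..d} \<Longrightarrow> \<bar>f z\<bar> \<le> 1"
  shows "\<bar>mu m n x y i j f\<bar> \<le> 5"
proof -
  have M: "\<bar>f (ptM m n x y i j)\<bar> \<le> 1" for i j
    by (rule f) (use midknot_bounds[OF px] midknot_bounds[OF py] in \<open>auto simp: ptM_def\<close>)
  have neg: "\<bar>q * f (ptM m n x y i j)\<bar> \<le> - q" if "q \<le> 0" for q i j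
    using mult_mono[OF order_refl M, of "- q" i j] that by (simp add: abs_mult)
  note X = coef_bounds[OF px, of i] and Y = coef_bounds[OF py, of j]
  have b: "\<bar>coef_b m n x y i j * f (ptM m n x y i j)\<bar> \<le> coef_b m n x y i j"
  proof -
    have "0 \<le> coef_b m n x y i j" using X(1,2) Y(1,2) by (simp add: coef_b_def)
    then show ?thesis using mult_left_mono[OF M, of "coef_b m n x y i j" i j] by (simp add: abs_mult)
  qed
  show ?thesis
    using b neg[OF X(1), of "i-1" j] neg[OF X(2), of "i+1" j] neg[OF Y(1), of i "j-1"] neg[OF Y(2), of i "j+1"]
      X(3) Y(3)
    unfolding mu_def coef_b_def by linarith
qed

lemma mu_star_bound:
  assumes px: "is_partition m a b x" and py: "is_partition n c d y"
    and f: "\<And>z. z \<in> {a..b} \<times> {c..d} \<Longrightarrow> \<bar>f z\<bar> \<le> 1"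
  shows "\<bar>mu_star m n x y i j f\<bar> \<le> 3"
proof -
  have M: "\<bar>f (ptM m n x y i j)\<bar> \<le> 1"
    by (rule f) (use midknot_bounds[OF px] midknot_bounds[OF py] in \<open>auto simp: ptM_def\<close>)
  have A: "\<bar>f (ptA m n x y i j)\<bar> \<le> 1" for i j
    by (rule f) (use knot_bounds[OF px] knot_bounds[OF py] in \<open>auto simp: ptA_def\<close>)
  have "\<bar>2 * p - (q + r + s + t) / 4\<bar> \<le> 3"
    if "\<bar>p\<bar> \<le> 1" "\<bar>q\<bar> \<le> 1" "\<bar>r\<bar> \<le> 1" "\<bar>s\<bar> \<le> 1" "\<bar>t\<bar> \<le> 1" for p q r s t :: real
    using that by (simp add: abs_le_iff field_simps)
  from this[OF M A A A A] show ?thesis unfolding mu_star_def .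
qed

lemma op_norm_le:
  fixes C :: real
  assumes "\<And>f z. (\<And>w. w \<in> \<Omega> \<Longrightarrow> \<bar>f w\<bar> \<le> 1) \<Longrightarrow> z \<in> \<Omega> \<Longrightarrow> \<bar>Q f z\<bar> \<le> C"
  shows "op_norm \<Omega> Q \<le> ereal C"
proof -
  have "\<bar>Q f z\<bar> \<le> C" if f: "sup_norm \<Omega> f \<le> 1" and z: "z \<in> \<Omega>" for f z
  proof (rule assms[OF _ z])
    fix w assume "w \<in> \<Omega>"
    then have "ereal \<bar>f w\<bar> \<le> sup_norm \<Omega> f" unfolding sup_norm_def by (rule SUP_upper)
    then have "ereal \<bar>f w\<bar> \<le> 1" using f by (rule order_trans)
    then show "\<bar>f w\<bar> \<le> 1" by simp
  qed
  then show ?thesis unfolding op_norm_def sup_norm_def[of \<Omega> "Q _"]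
    by (intro SUP_least) auto
qed

theorem mainTheorem1:
  fixes a b c d :: real and m n :: int and x y u v :: "int \<Rightarrow> real"
  assumes "is_partition m a b x" and "is_partition n c d y"
    and "extended_knots m x u" and "extended_knots n y v"
  shows "op_norm ({a..b} \<times> {c..d}) (S2 m n x y u v) \<le> 5
       \<and> op_norm ({a..b} \<times> {c..d}) (W2_star m n x y u v) \<le> 3"
proof -
  note B = bspline_nonneg_sum[OF assms]
  have "op_norm ({a..b} \<times> {c..d}) (S2 m n x y u v) \<le> ereal 5"
    unfolding S2_def
    by (intro op_norm_le quasi_interpolant_bound B mu_bound[OF assms(1,2)])
  moreover have "op_norm ({a..b} \<times> {c..d}) (W2_star m n x y u v) \<le> ereal 3"
    unfolding W2_star_def
    by (intro op_norm_le quasi_interpolant_bound B mu_star_bound[OF assms(1,2)])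
  ultimately show ?thesis by simp
qed

end
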